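(* Let $D=\{x_1<\dots<x_n\}\subset\mathbb{R}$ and $F:D\to\mathbb{R}$ with $F(x_i)\neq F(x_{i+1})$ for $i=1,\dots,n-1$. Let $\delta>0$ and let $y_1<y_2<\dots<y_{K+1}$ be a maximal alternating sequence of $\delta$-extrema of $F$. Let $P$ be the corresponding maximal alternating $\delta$-segmentation, i.e. the segmentation of $D$ into the $K$ segments determined by the points $x_1,y_2,\dots,y_K,x_n$. Then any segmentation $Q$ of $F$ with alternating monotonicity satisfying $\mathrm{OMAFE}(Q)<\mathrm{OMAFE}(P)$ has at least $K+1$ segments.
   Context: Extrema: $x_i$ is a maximum of $F$ if ($i\neq1$ implies $F(x_i)>F(x_{i-1})$) and ($i\neq n$ implies $F(x_i)>F(x_{i+1})$); minima analogously with reversed inequalities. $\ast$-pairs: for $\delta>0$, a pair $(x,y)$, $x<y$ in $D$, is a $\delta$-pair if $|F(y)-F(x)|\ge\delta$ and every $z\in D$ with $x<z<y$ satisfies $|F(z)-F(x)|<\delta$ and $|F(y)-F(z)|<\delta$; its direction is increasing if $F(y)>F(x)$, decreasing if $F(y)<F(x)$. A $\ast$-pair is a $\delta$-pair for some $\delta>0$; its scale is $|F(y)-F(x)|$. $(z_1,z_2)$ contains $(x,y)$ if $z_1\le x<y\le z_2$. A $\ast$-pair $(x,y)$ is maximal if whenever $(z_1,z_2)$ is a $\ast$-pair of strictly larger scale, same direction, containing $(x,y)$, there is a $\ast$-pair of opposite direction contained in $(z_1,z_2)$ and containing $(x,y)$. Scale labelling: the scale label of an extremum $x$ is the maximum of the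 scales of the maximal $\ast$-pairs of which $x$ is an end point. A maximal alternating sequence of $\delta$-extrema is a sequence $y_1<\dots<y_{K+1}$ of extrema, each with scale label at least $\delta$, whose types (maximum/minimum) alternate along the sequence, and such that no sequence properly containing it has these same properties. Segmentations and OMAFE: a segmentation into $m$ segments is given by points $x_1=u_1<u_2<\dots<u_{m+1}=x_n$ of $D$, with segments $[u_j,u_{j+1}]$. A segment $[a,b]$ is increasing if $F(b)>F(a)$, decreasing if $F(b)<F(a)$, without direction if $F(a)=F(b)$. The OMAFE of the segment is $\min_{f\in\Omega}\max_{x\in D\cap[a,b]}|f(x)-F(x)|$ with $\Omega$ the set of nondecreasing (resp. nonincreasing) functions $\mathbb{R}\to\mathbb{R}$ for an increasing (resp. decreasing) segment, and $(\max F(D\cap[a,b])-\min F(D\cap[a,b]))/2$ for a segment without direction. The OMAFE of a segmentation is the maximum of the OMAFEs of its segments (computed independently). A segmentation has alternating monotonicity if consecutive segments have opposite directions. *)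

theory Defs
  imports Complex_Main
begin

(* The domain D = {x_1 < ... < x_n} is the set of entries of a strictly increasing list xs
   (so xs ! i is x_{i+1}).  The function F : D -> R is represented by a function on all reals;
   every notion below evaluates it at points of D only. *)

definition is_maximum :: "real list \<Rightarrow> (real \<Rightarrow> real) \<Rightarrow> real \<Rightarrow> bool" where
  "is_maximum xs F x \<longleftrightarrow>
     (\<exists>i < length xs. x = xs ! i \<and>
        (i \<noteq> 0 \<longrightarrow> F (xs ! i) > F (xs ! (i - 1))) \<and>
        (Suc i \<noteq> length xs \<longrightarrow> F (xs ! i) > F (xs ! Suc i)))"

definition is_minimum :: "real list \<Rightarrow> (real \<Rightarrow> real) \<Rightarrow> real \<Rightarrow> bool" where
  "is_minimum xs F x \<longleftrightarrow>
     (\<exists>i < length xs. x = xs ! i \<and>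
        (i \<noteq> 0 \<longrightarrow> F (xs ! i) < F (xs ! (i - 1))) \<and>
        (Suc i \<noteq> length xs \<longrightarrow> F (xs ! i) < F (xs ! Suc i)))"

definition is_extremum :: "real list \<Rightarrow> (real \<Rightarrow> real) \<Rightarrow> real \<Rightarrow> bool" where
  "is_extremum xs F x \<longleftrightarrow> is_maximum xs F x \<or> is_minimum xs F x"

definition delta_pair ::
    "real list \<Rightarrow> (real \<Rightarrow> real) \<Rightarrow> real \<Rightarrow> real \<Rightarrow> real \<Rightarrow> bool" where
  "delta_pair xs F \<delta> x y \<longleftrightarrow>
     x \<in> set xs \<and> y \<in> set xs \<and> x < y \<and> \<bar>F y - F x\<bar> \<ge> \<delta> \<and>
     (\<forall>z \<in> set xs. x < z \<and> z < y \<longrightarrow> \<bar>F z - F x\<bar> < \<delta> \<and> \<bar>F y - F z\<bar> < \<delta>)"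

definition star_pair :: "real list \<Rightarrow> (real \<Rightarrow> real) \<Rightarrow> real \<Rightarrow> real \<Rightarrow> bool" where
  "star_pair xs F x y \<longleftrightarrow> (\<exists>\<delta>>0. delta_pair xs F \<delta> x y)"

definition scale :: "(real \<Rightarrow> real) \<Rightarrow> real \<Rightarrow> real \<Rightarrow> real" where
  "scale F x y = \<bar>F y - F x\<bar>"

(* "increasing" and "decreasing" are used both for pairs (x, y) and for segments [a, b];
   in either case the direction is decided by the values at the two ends. *)

definition increasing :: "(real \<Rightarrow> real) \<Rightarrow> real \<Rightarrow> real \<Rightarrow> bool" where
  "increasing F a b \<longleftrightarrow> F b > F a"

definition decreasing :: "(real \<Rightarrow> real) \<Rightarrow> real \<Rightarrow> real \<Rightarrow> bool" where
  "decreasing F a b \<longleftrightarrow> F b < F a"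

definition same_direction ::
    "(real \<Rightarrow> real) \<Rightarrow> real \<Rightarrow> real \<Rightarrow> real \<Rightarrow> real \<Rightarrow> bool" where
  "same_direction F a b c d \<longleftrightarrow>
     (increasing F a b \<and> increasing F c d) \<or> (decreasing F a b \<and> decreasing F c d)"

definition opposite_direction ::
    "(real \<Rightarrow> real) \<Rightarrow> real \<Rightarrow> real \<Rightarrow> real \<Rightarrow> real \<Rightarrow> bool" where
  "opposite_direction F a b c d \<longleftrightarrow>
     (increasing F a b \<and> decreasing F c d) \<or> (decreasing F a b \<and> increasing F c d)"

definition pair_contains :: "real \<Rightarrow> real \<Rightarrow> real \<Rightarrow> real \<Rightarrow> bool" where
  "pair_contains z1 z2 x y \<longleftrightarrow> z1 \<le> x \<and> x < y \<and> y \<le> z2"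

definition maximal_star_pair :: "real list \<Rightarrow> (real \<Rightarrow> real) \<Rightarrow> real \<Rightarrow> real \<Rightarrow> bool" where
  "maximal_star_pair xs F x y \<longleftrightarrow>
     star_pair xs F x y \<and>
     (\<forall>z1 z2. star_pair xs F z1 z2 \<and> scale F z1 z2 > scale F x y \<and>
              same_direction F z1 z2 x y \<and> pair_contains z1 z2 x y \<longrightarrow>
        (\<exists>w1 w2. star_pair xs F w1 w2 \<and> opposite_direction F w1 w2 x y \<and>
                 pair_contains z1 z2 w1 w2 \<and> pair_contains w1 w2 x y))"

(* All scales are positive, so inserting 0 does not change the maximum unless no maximal
   pair ends at x; in that case (for example if D is a single point) the label is 0. *)

definition scale_label :: "real list \<Rightarrow> (real \<Rightarrow> real) \<Rightarrow> real \<Rightarrow> real" where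
  "scale_label xs F x =
     Max (insert 0 {scale F a b | a b. maximal_star_pair xs F a b \<and> (x = a \<or> x = b)})"

definition alternating_delta_extrema ::
    "real list \<Rightarrow> (real \<Rightarrow> real) \<Rightarrow> real \<Rightarrow> real list \<Rightarrow> bool" where
  "alternating_delta_extrema xs F \<delta> ys \<longleftrightarrow>
     sorted_wrt (<) ys \<and>
     (\<forall>y \<in> set ys. is_extremum xs F y \<and> scale_label xs F y \<ge> \<delta>) \<and>
     (\<forall>i. Suc i < length ys \<longrightarrow>
        (is_maximum xs F (ys ! i) \<and> is_minimum xs F (ys ! Suc i)) \<or>
        (is_minimum xs F (ys ! i) \<and> is_maximum xs F (ys ! Suc i)))"

(* A strictly increasing list is determined by its set of entries, so containment of
   sequences is inclusion of these sets. *)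

definition maximal_alternating_delta_extrema ::
    "real list \<Rightarrow> (real \<Rightarrow> real) \<Rightarrow> real \<Rightarrow> real list \<Rightarrow> bool" where
  "maximal_alternating_delta_extrema xs F \<delta> ys \<longleftrightarrow>
     alternating_delta_extrema xs F \<delta> ys \<and>
     \<not> (\<exists>zs. alternating_delta_extrema xs F \<delta> zs \<and> set ys \<subset> set zs)"

definition segmentation :: "real list \<Rightarrow> nat \<Rightarrow> real list \<Rightarrow> bool" where
  "segmentation xs m us \<longleftrightarrow>
     length us = m + 1 \<and> sorted_wrt (<) us \<and> set us \<subseteq> set xs \<and>
     hd us = hd xs \<and> last us = last xs"

(* Since D is finite, the infimum over monotone functions is attained, so it is the minimum. *)

definition omafe_segment :: "real list \<Rightarrow> (real \<Rightarrow> real) \<Rightarrow> real \<Rightarrow> real \<Rightarrow> real" where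
  "omafe_segment xs F a b =
     (if increasing F a b then
        (INF f \<in> {f :: real \<Rightarrow> real. mono f}. Max ((\<lambda>x. \<bar>f x - F x\<bar>) ` (set xs \<inter> {a..b})))
      else if decreasing F a b then
        (INF f \<in> {f :: real \<Rightarrow> real. antimono f}. Max ((\<lambda>x. \<bar>f x - F x\<bar>) ` (set xs \<inter> {a..b})))
      else (Max (F ` (set xs \<inter> {a..b})) - Min (F ` (set xs \<inter> {a..b}))) / 2)"

definition omafe :: "real list \<Rightarrow> (real \<Rightarrow> real) \<Rightarrow> real list \<Rightarrow> real" where
  "omafe xs F us =
     Max ((\<lambda>j. omafe_segment xs F (us ! j) (us ! Suc j)) ` {..<length us - 1})"

definition alternating_monotonicity :: "(real \<Rightarrow> real) \<Rightarrow> real list \<Rightarrow> bool" where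
  "alternating_monotonicity F us \<longleftrightarrow>
     (\<forall>j. Suc (Suc j) < length us \<longrightarrow>
        opposite_direction F (us ! j) (us ! Suc j) (us ! Suc j) (us ! Suc (Suc j)))"

(* From y_1, ..., y_{K+1} to the points x_1, y_2, ..., y_K, x_n. *)

definition corresponding_segmentation :: "real list \<Rightarrow> real list \<Rightarrow> real list" where
  "corresponding_segmentation xs ys = hd xs # butlast (tl ys) @ [last xs]"

end

(* Between two adjacent extrema of a maximal alternating sequence there is no movement of size
   delta against the direction of the pair, since a largest such movement would yield two further
   delta-extrema; likewise the values before the first and after the last extremum stay within
   delta of it.  So the sequence is a zigzag with K steps of size at least delta, and e = 2 OMAFE(P),
   which is the largest movement against the direction of some segment of P, is below delta.
   Adding that movement to the sequence gives a zigzag with at least K + 1 steps of size at least e.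
   If OMAFE(Q) < e / 2, no segment of Q contains a step against its own direction, and then
   the alternating directions of Q force at least as many segments as there are steps. *)

theory Submission
  imports Defs
begin

text \<open>The scale label speaks only of maximal star pairs, and these may reach far outside the
  gap between two neighbouring extrema. Its usable local consequence is a barrier: if
  \<open>F\<close> takes a value below that of a delta-minimum \<open>p\<close> at some point
  \<open>z\<close>, then between \<open>p\<close> and \<open>z\<close> it reaches
  \<open>F p + \<delta>\<close>. The size of the gaps and all bounds inside and outside them come
  from barriers. Creating new extrema is the converse problem: a movement has to be extended to a
  maximal pair, and the place where the extension ends must be controlled. What makes this possible
  is that overlapping star pairs of opposite direction are always nested. The factor 2 arises
  because the best monotone approximation misses a function by half of its largest movement against
  the direction. Replacing \<open>F\<close> by its negative exchanges the directions, so only minima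
  and rises need arguments of their own.\<close>

text \<open>A star pair is increasing iff it is rising for \<open>F\<close>, and decreasing iff it is rising
  for \<open>- F\<close>.\<close>

definition rising :: "real set \<Rightarrow> (real \<Rightarrow> real) \<Rightarrow> real \<Rightarrow> real \<Rightarrow> bool" where
  "rising D F x y \<longleftrightarrow> x \<in> D \<and> y \<in> D \<and> x < y \<and> F x < F y \<and>
     (\<forall>z\<in>D. x < z \<and> z < y \<longrightarrow> F x < F z \<and> F z < F y)"

definition maximal_rising :: "real set \<Rightarrow> (real \<Rightarrow> real) \<Rightarrow> real \<Rightarrow> real \<Rightarrow> bool" where
  "maximal_rising D F x y \<longleftrightarrow> rising D F x y \<and>
     (\<forall>z1 z2. rising D F z1 z2 \<and> F y - F x < F z2 - F z1 \<and> z1 \<le> x \<and> y \<le> z2 \<longrightarrow>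
        (\<exists>w1 w2. rising D (\<lambda>x. - F x) w1 w2 \<and> z1 \<le> w1 \<and> w1 \<le> x \<and> y \<le> w2 \<and> w2 \<le> z2))"

text \<open>For \<open>\<delta> > 0\<close> these are the minima with scale label at least \<open>\<delta>\<close>: a minimum can only be
  the lower end point of a star pair.\<close>

definition delta_min :: "real set \<Rightarrow> (real \<Rightarrow> real) \<Rightarrow> real \<Rightarrow> real \<Rightarrow> bool" where
  "delta_min D F \<delta> p \<longleftrightarrow>
     (\<exists>y. maximal_rising D F p y \<and> \<delta> \<le> F y - F p) \<or>
     (\<exists>y. maximal_rising D (\<lambda>x. - F x) y p \<and> \<delta> \<le> F y - F p)"

abbreviation delta_max :: "real set \<Rightarrow> (real \<Rightarrow> real) \<Rightarrow> real \<Rightarrow> real \<Rightarrow> bool" where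
  "delta_max D F \<delta> p \<equiv> delta_min D (\<lambda>x. - F x) \<delta> p"

lemma delta_min_in: "delta_min D F \<delta> p \<Longrightarrow> p \<in> D"
  by (auto simp: delta_min_def maximal_rising_def rising_def)

section \<open>Nesting and maximal extension of star pairs\<close>

lemma finite_obtain_arg_min:
  fixes g :: "'a \<Rightarrow> real"
  assumes "finite S" "S \<noteq> {}"
  obtains x where "x \<in> S" "\<And>y. y \<in> S \<Longrightarrow> g x \<le> g y"
  using arg_min_if_finite(1)[OF assms, of g] arg_min_least[OF assms, of _ g] by blast

text \<open>A narrowest pair among those that start no higher than \<open>s\<close> and end no lower
  than \<open>t\<close> works: an intermediate point violating the definition could replace one of
  its ends. Thus every movement contains a star pair of at least its size.\<close>

lemma rising_within:
  assumes "finite D" "s \<in> D" "t \<in> D" "s < t" "F s < F t"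
  obtains x y where "rising D F x y" "s \<le> x" "y \<le> t" "F x \<le> F s" "F t \<le> F y"
proof -
  define S where "S = {(x, y). x \<in> D \<and> y \<in> D \<and> s \<le> x \<and> x < y \<and> y \<le> t \<and> F x \<le> F s \<and> F t \<le> F y}"
  have "S \<subseteq> D \<times> D" by (auto simp: S_def)
  then have "finite S" using assms(1) by (meson finite_SigmaI finite_subset)
  moreover have "(s, t) \<in> S" using assms by (auto simp: S_def)
  ultimately obtain xy where xy: "xy \<in> S" and
    least: "\<And>v. v \<in> S \<Longrightarrow> snd xy - fst xy \<le> snd v - fst v"
    using finite_obtain_arg_min[of S "\<lambda>v. snd v - fst v"] by blast
  obtain x y where eq: "xy = (x, y)" by (cases xy)
  have "F x < F z \<and> F z < F y" if z: "z \<in> D" "x < z" "z < y" for z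
  proof (intro conjI; rule ccontr)
    assume "\<not> F x < F z"
    then have "(z, y) \<in> S" using xy z by (auto simp: S_def eq)
    from least[OF this] z show False by (simp add: eq)
  next
    assume "\<not> F z < F y"
    then have "(x, z) \<in> S" using xy z by (auto simp: S_def eq)
    from least[OF this] z show False by (simp add: eq)
  qed
  then have "rising D F x y" using xy assms(5) by (auto simp: S_def eq rising_def)
  then show thesis using that xy by (auto simp: S_def eq)
qed

text \<open>An end of one pair that lies strictly inside the other has a value strictly between the
  end values there. If the pairs crossed or shared an end, these inequalities would contradict each
  other.\<close>

lemma opposite_pairs_nested:
  assumes "rising D F z1 z2" "rising D (\<lambda>x. - F x) w1 w2" "w1 < z2" "z1 < w2"
  shows "z1 < w1 \<and> w2 < z2 \<or> w1 < z1 \<and> z2 < w2"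
proof -
  have Z: "z1 \<in> D" "z2 \<in> D" "F z1 < F z2" "\<And>z. z \<in> D \<Longrightarrow> z1 < z \<Longrightarrow> z < z2 \<Longrightarrow> F z1 < F z \<and> F z < F z2"
    and W: "w1 \<in> D" "w2 \<in> D" "F w2 < F w1" "\<And>z. z \<in> D \<Longrightarrow> w1 < z \<Longrightarrow> z < w2 \<Longrightarrow> F w2 < F z \<and> F z < F w1"
    using assms(1,2) by (auto simp: rising_def)
  show ?thesis
    using Z(1-3) W(1-3) Z(4)[OF W(1)] Z(4)[OF W(2)] W(4)[OF Z(1)] W(4)[OF Z(2)] assms(3,4)
    by (smt (verit))
qed

text \<open>The witness has the largest rise among the pairs around \<open>(x, y)\<close> that no
  falling pair separates from \<open>(x, y)\<close>. For a still larger pair around it such a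
  falling pair exists; it cannot lie inside the witness, so by nestedness it contains it, as
  maximality demands. The last conclusion is kept because it later decides between two extensions
  that both reach too far.\<close>

lemma rising_extends_to_maximal:
  assumes "finite D" "rising D F x y"
  obtains z1 z2 where "maximal_rising D F z1 z2" "z1 \<le> x" "y \<le> z2" "F z1 \<le> F x" "F y \<le> F z2"
    "\<And>w1 w2. rising D (\<lambda>x. - F x) w1 w2 \<Longrightarrow> z1 \<le> w1 \<Longrightarrow> w1 \<le> x \<Longrightarrow> y \<le> w2 \<Longrightarrow> w2 \<le> z2 \<Longrightarrow> False"
proof -
  have xy: "x < y" "F x < F y" "x \<in> D" "y \<in> D" using assms(2) by (auto simp: rising_def)
  define S where "S = {(z1, z2). rising D F z1 z2 \<and> z1 \<le> x \<and> y \<le> z2 \<and>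
    (\<forall>w1 w2. \<not> (rising D (\<lambda>x. - F x) w1 w2 \<and> z1 \<le> w1 \<and> w1 \<le> x \<and> y \<le> w2 \<and> w2 \<le> z2))}"
  have "S \<subseteq> D \<times> D" by (auto simp: S_def rising_def)
  then have "finite S" using assms(1) by (meson finite_SigmaI finite_subset)
  moreover have "(x, y) \<in> S"
    using opposite_pairs_nested[OF assms(2)] assms(2) xy(1) by (fastforce simp: S_def)
  ultimately obtain z where z: "z \<in> S" and
    least: "\<And>v. v \<in> S \<Longrightarrow> - (F (snd z) - F (fst z)) \<le> - (F (snd v) - F (fst v))"
    using finite_obtain_arg_min[of S "\<lambda>v. - (F (snd v) - F (fst v))"] by blast
  obtain z1 z2 where eq: "z = (z1, z2)" by (cases z)
  have zr: "rising D F z1 z2" "z1 \<le> x" "y \<le> z2"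
    and free: "\<And>w1 w2. rising D (\<lambda>x. - F x) w1 w2 \<Longrightarrow> z1 \<le> w1 \<Longrightarrow> w1 \<le> x \<Longrightarrow> y \<le> w2 \<Longrightarrow> w2 \<le> z2 \<Longrightarrow> False"
    using z by (auto simp: S_def eq)
  have "maximal_rising D F z1 z2"
    unfolding maximal_rising_def
  proof (intro conjI allI impI zr(1))
    fix v1 v2
    assume v: "rising D F v1 v2 \<and> F z2 - F z1 < F v2 - F v1 \<and> v1 \<le> z1 \<and> z2 \<le> v2"
    show "\<exists>w1 w2. rising D (\<lambda>x. - F x) w1 w2 \<and> v1 \<le> w1 \<and> w1 \<le> z1 \<and> z2 \<le> w2 \<and> w2 \<le> v2"
    proof (rule ccontr)
      assume no: "\<not> ?thesis"
      have "(v1, v2) \<notin> S" using least[of "(v1, v2)"] v by (auto simp: eq)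
      then obtain w1 w2 where w: "rising D (\<lambda>x. - F x) w1 w2" "v1 \<le> w1" "w1 \<le> x" "y \<le> w2" "w2 \<le> v2"
        using v zr by (auto simp: S_def)
      have "z1 < w1 \<and> w2 < z2 \<or> w1 < z1 \<and> z2 < w2"
        using opposite_pairs_nested[OF zr(1) w(1)] w zr xy by linarith
      moreover have "\<not> (z1 < w1 \<and> w2 < z2)"
        using free[OF w(1)] w(3,4) by auto
      ultimately have "w1 \<le> z1" "z2 \<le> w2" by auto
      then show False using no w(1,2,5) by blast
    qed
  qed
  moreover have "F z1 \<le> F x" "F y \<le> F z2"
    using zr(2,3) zr(1)[unfolded rising_def] xy by (cases "z1 = x"; cases "z2 = y"; force)+
  ultimately show thesis using that zr free by blast
qed

section \<open>Barriers at maximal pairs and at delta-extrema\<close>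

text \<open>Otherwise the last point \<open>v\<close> before \<open>x\<close> with a value below
  \<open>F x\<close> makes \<open>(v, y)\<close> a larger rising pair. A falling pair between it and
  \<open>(x, y)\<close> would also end at \<open>y\<close>, which nestedness forbids.\<close>

lemma maximal_rising_barrier_left:
  assumes "finite D" "maximal_rising D F x y" "z \<in> D" "z < x" "F z < F x"
  obtains w where "w \<in> D" "z < w" "w < x" "F y \<le> F w"
proof (rule ccontr)
  assume no: "\<not> thesis"
  note found = that
  note r = assms(2)[unfolded maximal_rising_def rising_def]
  let ?S = "{v \<in> D. v < x \<and> F v < F x}"
  define v where "v = Max ?S"
  have "finite ?S" "z \<in> ?S" using assms by auto
  then have v: "v \<in> ?S" and vmax: "\<And>u. u \<in> ?S \<Longrightarrow> u \<le> v"
    unfolding v_def by (metis (no_types, lifting) Max_in empty_iff, simp)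
  have "z \<le> v" using vmax \<open>z \<in> ?S\<close> by blast
  have low: "F u < F y" if "u \<in> D" "v < u" "u < x" for u
    using no found[of u] that \<open>z \<le> v\<close> by force
  have high: "F x \<le> F u" if "u \<in> D" "v < u" "u < x" for u
    using vmax[of u] that by force
  have rv: "rising D F v y"
    unfolding rising_def
  proof (intro conjI ballI impI)
    fix u assume u: "u \<in> D" "v < u \<and> u < y"
    show "F v < F u" "F u < F y"
      using u v r high[of u] low[of u] by (cases u x rule: linorder_cases; force)+
  qed (use v r in auto)
  obtain w1 w2 where w: "rising D (\<lambda>x. - F x) w1 w2" "v \<le> w1" "w1 \<le> x" "y \<le> w2" "w2 \<le> y"
    using assms(2) rv v unfolding maximal_rising_def by force
  show False using opposite_pairs_nested[OF rv w(1)] w r v by force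
qed

text \<open>Here \<open>v\<close> is the first point after \<open>y\<close> with a value above
  \<open>F y\<close>, and a separating falling pair would have to start at \<open>x\<close>.\<close>

lemma maximal_rising_barrier_right:
  assumes "finite D" "maximal_rising D F x y" "z \<in> D" "y < z" "F y < F z"
  obtains w where "w \<in> D" "y < w" "w < z" "F w \<le> F x"
proof (rule ccontr)
  assume no: "\<not> thesis"
  note found = that
  note r = assms(2)[unfolded maximal_rising_def rising_def]
  let ?S = "{v \<in> D. y < v \<and> F y < F v}"
  define v where "v = Min ?S"
  have "finite ?S" "z \<in> ?S" using assms by auto
  then have v: "v \<in> ?S" and vmin: "\<And>u. u \<in> ?S \<Longrightarrow> v \<le> u"
    unfolding v_def by (metis (no_types, lifting) Min_in empty_iff, simp)
  have "v \<le> z" using vmin \<open>z \<in> ?S\<close> by blast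
  have high: "F x < F u" if "u \<in> D" "y < u" "u < v" for u
    using no found[of u] that \<open>v \<le> z\<close> by force
  have low: "F u \<le> F y" if "u \<in> D" "y < u" "u < v" for u
    using vmin[of u] that by force
  have rv: "rising D F x v"
    unfolding rising_def
  proof (intro conjI ballI impI)
    fix u assume u: "u \<in> D" "x < u \<and> u < v"
    show "F x < F u" "F u < F v"
      using u v r high[of u] low[of u] by (cases u y rule: linorder_cases; force)+
  qed (use v r in auto)
  obtain w1 w2 where w: "rising D (\<lambda>x. - F x) w1 w2" "x \<le> w1" "w1 \<le> x" "y \<le> w2" "w2 \<le> v"
    using assms(2) rv v unfolding maximal_rising_def by force
  show False using opposite_pairs_nested[OF rv w(1)] w r v by force
qed

text \<open>If the label stems from a rise starting at \<open>p\<close>, the barrier is that of the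
  pair. If it stems from a fall \<open>(y, p)\<close>, all points from \<open>y\<close> up to
  \<open>p\<close> are higher than \<open>p\<close>, so \<open>z\<close> precedes \<open>y\<close>
  and \<open>y\<close> itself is the barrier.\<close>

lemma delta_min_barrier_left:
  assumes "finite D" "delta_min D F \<delta> p" "z \<in> D" "z < p" "F z < F p"
  obtains w where "w \<in> D" "z < w" "w < p" "F p + \<delta> \<le> F w"
  using assms(2) unfolding delta_min_def
proof (elim disjE exE conjE)
  fix y assume y: "maximal_rising D F p y" "\<delta> \<le> F y - F p"
  show thesis
    using maximal_rising_barrier_left[OF assms(1) y(1) assms(3-5)] that y(2)
    by (smt (verit, best))
next
  fix y assume y: "maximal_rising D (\<lambda>x. - F x) y p" "\<delta> \<le> F y - F p"
  then have "y \<in> D" "y < p" "z < y"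
    using assms(3-5) by (auto simp: maximal_rising_def rising_def)
      (metis linorder_neqE_linordered_idom neg_less_iff_less order_less_asym)
  then show thesis using that y(2) by force
qed

lemma delta_min_barrier_right:
  assumes "finite D" "delta_min D F \<delta> p" "z \<in> D" "p < z" "F z < F p"
  obtains w where "w \<in> D" "p < w" "w < z" "F p + \<delta> \<le> F w"
  using assms(2) unfolding delta_min_def
proof (elim disjE exE conjE)
  fix y assume y: "maximal_rising D (\<lambda>x. - F x) y p" "\<delta> \<le> F y - F p"
  show thesis
    using maximal_rising_barrier_right[OF assms(1) y(1) assms(3,4)] assms(5) that y(2)
    by (smt (verit, best))
next
  fix y assume y: "maximal_rising D F p y" "\<delta> \<le> F y - F p"
  then have "y \<in> D" "p < y" "y < z"
    using assms(3-5) by (auto simp: maximal_rising_def rising_def)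
      (metis linorder_neqE_linordered_idom order_less_asym)
  then show thesis using that y(2) by force
qed

lemma delta_max_barrier_left:
  assumes "finite D" "delta_max D F \<delta> p" "z \<in> D" "z < p" "F p < F z"
  obtains w where "w \<in> D" "z < w" "w < p" "F w + \<delta> \<le> F p"
proof -
  have "- F z < - F p" using assms(5) by simp
  from delta_min_barrier_left[OF assms(1-4) this]
  obtain w where "w \<in> D" "z < w" "w < p" "- F p + \<delta> \<le> - F w" .
  then show thesis using that[of w] by simp
qed

lemma delta_max_barrier_right:
  assumes "finite D" "delta_max D F \<delta> p" "z \<in> D" "p < z" "F p < F z"
  obtains w where "w \<in> D" "p < w" "w < z" "F w + \<delta> \<le> F p"
proof -
  have "- F z < - F p" using assms(5) by simp
  from delta_min_barrier_right[OF assms(1-4) this]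
  obtain w where "w \<in> D" "p < w" "w < z" "- F p + \<delta> \<le> - F w" .
  then show thesis using that[of w] by simp
qed

section \<open>Opposite movements between delta-extrema\<close>

text \<open>The fall into \<open>b\<close> and the rise out of it are extended to maximal pairs. If
  the first ends by \<open>q\<close>, its end has the level of \<open>b\<close>; if the second
  starts at \<open>a\<close> or later, its start does. Hence only the level of \<open>b\<close> is
  kept, not its position.\<close>

lemma delta_min_in_valley:
  assumes "finite D" "\<delta> > 0" "a \<in> D" "b \<in> D" "q \<in> D" "a < b" "b < q"
    "F b + \<delta> \<le> F a" "F b + \<delta> \<le> F q" "\<And>z. z \<in> D \<Longrightarrow> a \<le> z \<Longrightarrow> z \<le> q \<Longrightarrow> F b \<le> F z"
  obtains b' where "delta_min D F \<delta> b'" "a < b'" "b' < q" "F b' = F b"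
proof -
  obtain x y where xy: "rising D (\<lambda>x. - F x) x y" "a \<le> x" "y \<le> b" "- F x \<le> - F a" "- F b \<le> - F y"
    by (rule rising_within[OF assms(1,3,4,6), of "\<lambda>x. - F x"]) (use assms(2,8) in auto)
  obtain z1 z2 where z: "maximal_rising D (\<lambda>x. - F x) z1 z2" "z1 \<le> x" "y \<le> z2"
      "- F z1 \<le> - F x" "- F y \<le> - F z2"
    and zfree: "\<And>w1 w2. rising D (\<lambda>x. - (- F x)) w1 w2 \<Longrightarrow> z1 \<le> w1 \<Longrightarrow> w1 \<le> x \<Longrightarrow> y \<le> w2 \<Longrightarrow> w2 \<le> z2 \<Longrightarrow> False"
    by (rule rising_extends_to_maximal[OF assms(1) xy(1)]) (rule that)
  obtain x' y' where xy': "rising D F x' y'" "b \<le> x'" "y' \<le> q" "F x' \<le> F b" "F q \<le> F y'"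
    by (rule rising_within[OF assms(1,4,5,7), of F]) (use assms(2,9) in auto)
  obtain v1 v2 where v: "maximal_rising D F v1 v2" "v1 \<le> x'" "y' \<le> v2" "F v1 \<le> F x'" "F y' \<le> F v2"
    and vfree: "\<And>w1 w2. rising D (\<lambda>x. - F x) w1 w2 \<Longrightarrow> v1 \<le> w1 \<Longrightarrow> w1 \<le> x' \<Longrightarrow> y' \<le> w2 \<Longrightarrow> w2 \<le> v2 \<Longrightarrow> False"
    by (rule rising_extends_to_maximal[OF assms(1) xy'(1)]) (rule that)
  have ord: "x < y" "x' < y'" using xy(1) xy'(1) by (auto simp: rising_def)
  have rz: "rising D (\<lambda>x. - F x) z1 z2" "z2 \<in> D" and rv: "rising D F v1 v2" "v1 \<in> D"
    using z(1) v(1) by (auto simp: maximal_rising_def rising_def)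
  consider "z2 \<le> q" | "a \<le> v1" | "q < z2" "v1 < a" by linarith
  then show thesis
  proof cases
    case 1
    have "delta_min D F \<delta> z2" unfolding delta_min_def using z xy assms(8) by (smt (verit, best))
    moreover have "F z2 = F b" using assms(10)[OF rz(2)] 1 xy z ord by force
    ultimately show thesis using that[of z2] 1 xy z ord assms by force
  next
    case 2
    have "delta_min D F \<delta> v1" unfolding delta_min_def using v xy' assms(9) by (smt (verit, best))
    moreover have "F v1 = F b" using assms(10)[OF rv(2)] 2 xy' v ord by force
    ultimately show thesis using that[of v1] 2 xy' v ord assms by force
  next
    \<comment> \<open>Each extension runs past the far end of \<open>[a, q]\<close>, so they overlap
      and one is nested in the other. The inner one separates the outer from the pair it was
      extended from, contrary to \<open>zfree\<close> or \<open>vfree\<close>.\<close>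
    case 3
    have "v1 < z1 \<and> z2 < v2 \<or> z1 < v1 \<and> v2 < z2"
      using opposite_pairs_nested[OF rv(1) rz(1)] 3 xy xy' z v ord by linarith
    then show thesis
    proof
      assume "v1 < z1 \<and> z2 < v2"
      then have "v1 \<le> z1" "z1 \<le> x'" "y' \<le> z2" "z2 \<le> v2"
        using 3 xy(2,3) xy'(2,3) z(2,3) ord by linarith+
      then show thesis using vfree[OF rz(1)] by blast
    next
      assume *: "z1 < v1 \<and> v2 < z2"
      have "rising D (\<lambda>x. - (- F x)) v1 v2" using rv by simp
      moreover have "z1 \<le> v1" "v1 \<le> x" "y \<le> v2" "v2 \<le> z2"
        using * 3 xy(2,3) xy'(2,3) v(2,3) ord by linarith+
      ultimately show thesis using zfree by blast
    qed
  qed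
qed

text \<open>The extrema come from a largest fall inside the gap, of least length among those. The
  barriers of \<open>p\<close> and \<open>q\<close> keep their values at distance
  \<open>\<delta>\<close> from the far end of this fall, so its lower end lies in a valley and its
  upper end on a peak.\<close>

lemma delta_extrema_inside_gap:
  assumes "finite D" "\<delta> > 0" "delta_min D F \<delta> p" "delta_max D F \<delta> q"
    "s \<in> D" "t \<in> D" "p \<le> s" "s < t" "t \<le> q" "F t + \<delta> \<le> F s"
  obtains a b where "delta_max D F \<delta> a" "delta_min D F \<delta> b" "p < a" "a < b" "b < q"
proof -
  have pq: "p \<in> D" "q \<in> D" using assms(3,4) delta_min_in by auto
  define S where "S = {(a, b). a \<in> D \<and> b \<in> D \<and> p \<le> a \<and> a < b \<and> b \<le> q}"
  have "S \<subseteq> D \<times> D" by (auto simp: S_def)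
  then have fS: "finite S" using assms(1) by (meson finite_SigmaI finite_subset)
  have st: "(s, t) \<in> S" using assms by (auto simp: S_def)
  then obtain c where c: "c \<in> S" and
    least_c: "\<And>v. v \<in> S \<Longrightarrow> F (snd c) - F (fst c) \<le> F (snd v) - F (fst v)"
    using finite_obtain_arg_min[OF fS, of "\<lambda>v. F (snd v) - F (fst v)"] by blast
  define T where "T = {v \<in> S. F (snd v) - F (fst v) = F (snd c) - F (fst c)}"
  have "finite T" "c \<in> T" using fS c by (simp_all add: T_def)
  then obtain d where d: "d \<in> T" and short: "\<And>v. v \<in> T \<Longrightarrow> snd d - fst d \<le> snd v - fst v"
    using finite_obtain_arg_min[of T "\<lambda>v. snd v - fst v"] by (metis empty_iff)
  obtain a b where eq: "d = (a, b)" by (cases d)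
  have ab: "a \<in> D" "b \<in> D" "p \<le> a" "a < b" "b \<le> q" using d by (auto simp: T_def S_def eq)
  have big: "F a' - F b' \<le> F a - F b" if "a' \<in> D" "b' \<in> D" "p \<le> a'" "a' < b'" "b' \<le> q" for a' b'
    using least_c[of "(a', b')"] that d by (auto simp: T_def S_def eq)
  have shortest: "b - a \<le> b' - a'"
    if "a' \<in> D" "b' \<in> D" "p \<le> a'" "a' < b'" "b' \<le> q" "F a' = F a" "F b' = F b" for a' b'
    using short[of "(a', b')"] that d by (auto simp: T_def S_def eq)
  have drop: "F b + \<delta> \<le> F a" using big[of s t] assms by auto
  have low: "F b \<le> F z" if "z \<in> D" "a \<le> z" "z \<le> q" for z
    using big[of a z] that ab drop assms(2) by (cases "a = z") auto
  have high: "F z \<le> F a" if "z \<in> D" "p \<le> z" "z \<le> b" for z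
    using big[of z b] that ab drop assms(2) by (cases "b = z") auto
  have Fq: "F b + \<delta> \<le> F q"
  proof (cases "F a \<le> F q")
    case False
    then obtain w where "w \<in> D" "a < w" "w < q" "F w + \<delta> \<le> F q"
      using delta_max_barrier_left[OF assms(1,4) ab(1)] ab by force
    then show ?thesis using low[of w] by simp
  qed (use drop in simp)
  have Fp: "F p + \<delta> \<le> F a"
  proof (cases "F p \<le> F b")
    case False
    then obtain w where "w \<in> D" "p < w" "w < b" "F p + \<delta> \<le> F w"
      using delta_min_barrier_right[OF assms(1,3) ab(2)] ab by force
    then show ?thesis using high[of w] by simp
  qed (use drop in simp)
  have strict: "p < a" "b < q" using Fp Fq ab assms(2) by (auto simp: less_le)
  obtain b' where b': "delta_min D F \<delta> b'" "a < b'" "b' < q" "F b' = F b"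
    using delta_min_in_valley[OF assms(1,2) ab(1,2) pq(2) ab(4) strict(2) drop Fq low] by blast
  obtain a' where a': "delta_max D F \<delta> a'" "p < a'" "a' < b" "F a' = F a"
    using delta_min_in_valley[OF assms(1,2) pq(1) ab(1,2) strict(1) ab(4), of "\<lambda>x. - F x"]
      drop Fp high by force
  \<comment> \<open>The new extrema share only the levels of \<open>a\<close> and \<open>b\<close>,
    so their order is not yet known. The falls from \<open>a\<close> to \<open>b'\<close> and from
    \<open>a'\<close> to \<open>b\<close> are again largest ones, and least length gives
    \<open>a' \<le> a < b \<le> b'\<close>.\<close>
  have "b \<le> b'" using shortest[of a b'] ab b' delta_min_in by force
  moreover have "a' \<le> a" using shortest[of a' b] ab a' delta_min_in[OF a'(1)] by force
  ultimately show thesis using that a' b' ab by force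
qed

text \<open>A value outside the bounds would form, together with the barrier that it calls for, a
  drop of more than \<open>\<delta>\<close> inside the gap.\<close>

lemma no_drop_bounds:
  assumes "finite D" "\<delta> > 0" "delta_min D F \<delta> p" "delta_max D F \<delta> q" "z \<in> D" "p \<le> z" "z \<le> q"
    and no: "\<And>s t. s \<in> D \<Longrightarrow> t \<in> D \<Longrightarrow> p \<le> s \<Longrightarrow> s < t \<Longrightarrow> t \<le> q \<Longrightarrow> F s < F t + \<delta>"
  shows "F p \<le> F z" "F z \<le> F q"
proof -
  show "F p \<le> F z"
  proof (rule ccontr)
    assume *: "\<not> ?thesis"
    then obtain w where "w \<in> D" "p < w" "w < z" "F p + \<delta> \<le> F w"
      using delta_min_barrier_right[OF assms(1,3,5)] assms(6) by force
    then show False using no[of w z] assms * by force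
  qed
  show "F z \<le> F q"
  proof (rule ccontr)
    assume *: "\<not> ?thesis"
    then obtain w where "w \<in> D" "z < w" "w < q" "F w + \<delta> \<le> F q"
      using delta_max_barrier_left[OF assms(1,4,5)] assms(7) by force
    then show False using no[of z w] assms * by force
  qed
qed

text \<open>The label of one extremum provides a pair of scale at least \<open>\<delta>\<close>,
  whose other end may lie outside the gap. The barrier of the other extremum then gives a point
  \<open>w\<close>, and its value, confined by that pair or by the gap bounds, still forces the
  step.\<close>

lemma no_drop_step:
  assumes "finite D" "\<delta> > 0" "delta_min D F \<delta> p" "delta_max D F \<delta> q" "p < q"
    and no: "\<And>s t. s \<in> D \<Longrightarrow> t \<in> D \<Longrightarrow> p \<le> s \<Longrightarrow> s < t \<Longrightarrow> t \<le> q \<Longrightarrow> F s < F t + \<delta>"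
  shows "F p + \<delta> \<le> F q"
proof -
  have pq: "p \<in> D" "q \<in> D" using assms(3,4) delta_min_in by auto
  have bounds: "F p \<le> F z \<and> F z \<le> F q" if "z \<in> D" "p \<le> z" "z \<le> q" for z
    using no_drop_bounds[OF assms(1-4) that no] by blast
  consider (right) y where "maximal_rising D F p y" "\<delta> \<le> F y - F p"
    | (left) y where "maximal_rising D F y q" "\<delta> \<le> F q - F y"
    | (out) y where "maximal_rising D (\<lambda>x. - F x) q y" "\<delta> \<le> F q - F y"
    using assms(3,4) unfolding delta_min_def by force
  then show ?thesis
  proof cases
    case right
    then have y: "y \<in> D" "p < y" "\<And>z. z \<in> D \<Longrightarrow> p < z \<Longrightarrow> z < y \<Longrightarrow> F p < F z \<and> F z < F y"
      by (auto simp: maximal_rising_def rising_def)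
    show ?thesis
    proof (cases "y \<le> q")
      case True then show ?thesis using bounds[of y] y right by force
    next
      case False
      then obtain w where "w \<in> D" "q < w" "w < y" "F w + \<delta> \<le> F q"
        using delta_max_barrier_right[OF assms(1,4) y(1)] y(3)[of q] pq assms(5) by force
      then show ?thesis using y(3)[of w] assms(5) by force
    qed
  next
    case left
    then have y: "y \<in> D" "y < q" "\<And>z. z \<in> D \<Longrightarrow> y < z \<Longrightarrow> z < q \<Longrightarrow> F y < F z \<and> F z < F q"
      by (auto simp: maximal_rising_def rising_def)
    show ?thesis
    proof (cases "p \<le> y")
      case True then show ?thesis using bounds[of y] y left by force
    next
      case False
      then obtain w where "w \<in> D" "y < w" "w < p" "F p + \<delta> \<le> F w"
        using delta_min_barrier_left[OF assms(1,3) y(1)] y(3)[of p] pq assms(5) by force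
      then show ?thesis using y(3)[of w] assms(5) by force
    qed
  next
    case out
    then have y: "y \<in> D" "q < y" "\<And>z. z \<in> D \<Longrightarrow> q < z \<Longrightarrow> z < y \<Longrightarrow> F y < F z \<and> F z < F q"
      by (auto simp: maximal_rising_def rising_def)
    show ?thesis
    proof (rule ccontr)
      assume less: "\<not> ?thesis"
      then obtain w where w: "w \<in> D" "p < w" "w < y" "F p + \<delta> \<le> F w"
        using delta_min_barrier_right[OF assms(1,3) y(1)] y out assms(5) by force
      then show False using bounds[of w] y(3)[of w] less by (cases w q rule: linorder_cases) auto
    qed
  qed
qed

text \<open>One bound on each position is all that is needed: outside the first or last extremum,
  any new extremum of the right type extends the sequence.\<close>

lemma rise_delta_extrema:
  assumes "finite D" "\<delta> > 0" "a \<in> D" "b \<in> D" "a < b" "F a + \<delta> \<le> F b"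
  obtains z1 z2 where "delta_min D F \<delta> z1" "delta_max D F \<delta> z2" "z1 < b" "a < z2"
proof -
  obtain x y where xy: "rising D F x y" "a \<le> x" "y \<le> b" "F x \<le> F a" "F b \<le> F y"
    by (rule rising_within[OF assms(1,3-5), of F]) (use assms(2,6) in auto)
  obtain z1 z2 where z: "maximal_rising D F z1 z2" "z1 \<le> x" "y \<le> z2" "F z1 \<le> F x" "F y \<le> F z2"
    by (rule rising_extends_to_maximal[OF assms(1) xy(1)]) (rule that)
  have "\<delta> \<le> F z2 - F z1" "x < y" using xy z assms by (auto simp: rising_def)
  then show thesis using that[of z1 z2] z xy unfolding delta_min_def by force
qed

section \<open>Translation of star pairs and scale labels\<close>

text \<open>Distance less than \<open>\<delta>\<close> from both end values, which are at least
  \<open>\<delta>\<close> apart, squeezes \<open>F z\<close> strictly between them. Conversely the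
  scale itself serves as \<open>\<delta>\<close>.\<close>

lemma star_pair_iff_rising:
  "star_pair xs F x y \<longleftrightarrow> rising (set xs) F x y \<or> rising (set xs) (\<lambda>x. - F x) x y"
proof
  assume "star_pair xs F x y"
  then show "rising (set xs) F x y \<or> rising (set xs) (\<lambda>x. - F x) x y"
    unfolding star_pair_def delta_pair_def rising_def by (smt (verit))
next
  assume *: "rising (set xs) F x y \<or> rising (set xs) (\<lambda>x. - F x) x y"
  have "delta_pair xs F \<bar>F y - F x\<bar> x y" "\<bar>F y - F x\<bar> > 0"
    using * unfolding delta_pair_def rising_def by (smt (verit))+
  then show "star_pair xs F x y" unfolding star_pair_def by blast
qed

lemma increasing_maximal_star_pair_iff:
  assumes "F x < F y"
  shows "maximal_star_pair xs F x y \<longleftrightarrow> maximal_rising (set xs) F x y"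
proof -
  have r: "rising D F v w \<Longrightarrow> v < w \<and> F v < F w" for D F v w by (simp add: rising_def)
  have inc: "rising (set xs) F v w \<longleftrightarrow> star_pair xs F v w \<and> F v < F w"
    and dec: "rising (set xs) (\<lambda>x. - F x) v w \<longleftrightarrow> star_pair xs F v w \<and> F w < F v" for v w
    unfolding star_pair_iff_rising using r[of "set xs" F v w] r[of "set xs" "\<lambda>x. - F x" v w] by auto
  have lt: "star_pair xs F v w \<Longrightarrow> v < w" for v w
    by (auto simp: star_pair_def delta_pair_def)
  show ?thesis
  proof (cases "star_pair xs F x y")
    case True
    then have "x < y" by (rule lt)
    have outer: "star_pair xs F z1 z2 \<and> scale F z1 z2 > scale F x y \<and>
        same_direction F z1 z2 x y \<and> pair_contains z1 z2 x y \<longleftrightarrow>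
        (star_pair xs F z1 z2 \<and> F z1 < F z2) \<and> F y - F x < F z2 - F z1 \<and> z1 \<le> x \<and> y \<le> z2" for z1 z2
      using assms \<open>x < y\<close>
      by (auto simp: scale_def same_direction_def increasing_def decreasing_def pair_contains_def)
    have inner: "star_pair xs F w1 w2 \<and> opposite_direction F w1 w2 x y \<and>
        pair_contains z1 z2 w1 w2 \<and> pair_contains w1 w2 x y \<longleftrightarrow>
        (star_pair xs F w1 w2 \<and> F w2 < F w1) \<and> z1 \<le> w1 \<and> w1 \<le> x \<and> y \<le> w2 \<and> w2 \<le> z2"
      for z1 z2 w1 w2
      using assms \<open>x < y\<close>
      by (auto simp: opposite_direction_def increasing_def decreasing_def pair_contains_def)
    show ?thesis
      unfolding maximal_star_pair_def maximal_rising_def inc dec outer inner using assms by simp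
  qed (simp add: maximal_star_pair_def maximal_rising_def inc)
qed

lemma star_pair_uminus: "star_pair xs (\<lambda>x. - F x) x y \<longleftrightarrow> star_pair xs F x y"
  by (auto simp: star_pair_iff_rising)

lemma maximal_star_pair_uminus:
  "maximal_star_pair xs (\<lambda>x. - F x) x y \<longleftrightarrow> maximal_star_pair xs F x y"
proof -
  have "scale (\<lambda>x. - F x) = scale F" by (auto simp: scale_def fun_eq_iff)
  moreover have "same_direction (\<lambda>x. - F x) = same_direction F"
    "opposite_direction (\<lambda>x. - F x) = opposite_direction F"
    by (auto simp: same_direction_def opposite_direction_def increasing_def decreasing_def fun_eq_iff)
  ultimately show ?thesis by (simp add: maximal_star_pair_def star_pair_uminus)
qed

lemma maximal_star_pair_iff_rising:
  "maximal_star_pair xs F x y \<longleftrightarrow>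
     maximal_rising (set xs) F x y \<or> maximal_rising (set xs) (\<lambda>x. - F x) x y"
proof -
  have "F x < F y" if "maximal_rising (set xs) F x y" for F :: "real \<Rightarrow> real"
    using that by (auto simp: maximal_rising_def rising_def)
  then have 1: "maximal_rising (set xs) F x y \<longleftrightarrow> F x < F y \<and> maximal_star_pair xs F x y"
    for F :: "real \<Rightarrow> real" using increasing_maximal_star_pair_iff by blast
  have "F x \<noteq> F y" if "maximal_star_pair xs F x y"
    using that by (auto simp: maximal_star_pair_def star_pair_def delta_pair_def)
  then show ?thesis unfolding 1 maximal_star_pair_uminus by auto
qed

lemma scale_label_ge_iff:
  assumes "\<delta> > 0"
  shows "\<delta> \<le> scale_label xs F x \<longleftrightarrow>
    (\<exists>a b. maximal_star_pair xs F a b \<and> (x = a \<or> x = b) \<and> \<delta> \<le> scale F a b)"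
proof -
  let ?S = "{scale F a b | a b. maximal_star_pair xs F a b \<and> (x = a \<or> x = b)}"
  have "?S \<subseteq> (\<lambda>(a, b). scale F a b) ` (set xs \<times> set xs)"
    by (auto simp: maximal_star_pair_def star_pair_def delta_pair_def)
  then have "finite ?S" by (meson finite_SigmaI finite_imageI finite_set finite_subset)
  then have "\<delta> \<le> scale_label xs F x \<longleftrightarrow> (\<exists>s\<in>insert 0 ?S. \<delta> \<le> s)"
    unfolding scale_label_def by (subst Max_ge_iff) auto
  \<comment> \<open>The default 0 is never at least \<open>\<delta>\<close>, so only scales of
    actual pairs count.\<close>
  then show ?thesis using assms by auto
qed

lemma scale_label_uminus: "scale_label xs (\<lambda>x. - F x) = scale_label xs F"
proof -
  have "scale (\<lambda>x. - F x) = scale F" by (auto simp: scale_def fun_eq_iff)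
  then show ?thesis by (simp add: scale_label_def maximal_star_pair_uminus fun_eq_iff)
qed

lemma is_maximum_iff_minimum: "is_maximum xs F x \<longleftrightarrow> is_minimum xs (\<lambda>x. - F x) x"
  by (simp add: is_maximum_def is_minimum_def)

lemma scale_label_ge_iff_delta_extremum:
  assumes "\<delta> > 0"
  shows "\<delta> \<le> scale_label xs F x \<longleftrightarrow> delta_min (set xs) F \<delta> x \<or> delta_max (set xs) F \<delta> x"
proof -
  have s: "maximal_rising D F v w \<Longrightarrow> scale F v w = F w - F v"
    "maximal_rising D (\<lambda>x. - F x) v w \<Longrightarrow> scale F v w = F v - F w" for D v w
    by (auto simp: maximal_rising_def rising_def scale_def)
  show ?thesis
    unfolding scale_label_ge_iff[OF assms] maximal_star_pair_iff_rising delta_min_def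
    by (auto simp: s) (metis s)+
qed

lemma strict_sorted_nth_less_iff:
  fixes xs :: "real list"
  assumes "sorted_wrt (<) xs" "i < length xs" "j < length xs"
  shows "xs ! i < xs ! j \<longleftrightarrow> i < j"
  using sorted_wrt_nth_less[OF assms(1), of i j] sorted_wrt_nth_less[OF assms(1), of j i] assms(2,3)
  by (cases i j rule: linorder_cases) auto

text \<open>The left neighbour of \<open>y\<close> lies in \<open>[x, y)\<close>, where a rising
  pair stays below \<open>F y\<close>, whereas a minimum has a higher neighbour.\<close>

lemma minimum_not_top_of_rising:
  assumes "sorted_wrt (<) xs" "is_minimum xs F y" "rising (set xs) F x y"
  shows False
proof -
  obtain i where i: "i < length xs" "y = xs ! i" "i \<noteq> 0 \<longrightarrow> F y < F (xs ! (i - 1))"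
    using assms(2) by (auto simp: is_minimum_def)
  obtain j where j: "j < length xs" "x = xs ! j"
    using assms(3) by (auto simp: rising_def in_set_conv_nth)
  have "j < i"
    using assms(3) i j strict_sorted_nth_less_iff[OF assms(1)] by (auto simp: rising_def)
  then have "xs ! j = xs ! (i - 1) \<or> xs ! j < xs ! (i - 1)" "xs ! (i - 1) < xs ! i" "xs ! (i - 1) \<in> set xs"
    using i assms(1) by (cases "j = i - 1"; auto simp: sorted_wrt_nth_less)+
  then show False using assms(3) i j \<open>j < i\<close> by (auto simp: rising_def)
qed

lemma minimum_not_bottom_of_falling:
  assumes "sorted_wrt (<) xs" "is_minimum xs F x" "rising (set xs) (\<lambda>x. - F x) x y"
  shows False
proof -
  obtain i where i: "i < length xs" "x = xs ! i" "Suc i \<noteq> length xs \<longrightarrow> F x < F (xs ! Suc i)"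
    using assms(2) by (auto simp: is_minimum_def)
  obtain j where j: "j < length xs" "y = xs ! j"
    using assms(3) by (auto simp: rising_def in_set_conv_nth)
  have "i < j"
    using assms(3) i j strict_sorted_nth_less_iff[OF assms(1)] by (auto simp: rising_def)
  then have "xs ! j = xs ! Suc i \<or> xs ! Suc i < xs ! j" "xs ! i < xs ! Suc i" "xs ! Suc i \<in> set xs"
    "Suc i < length xs"
    using i j assms(1) by (cases "j = Suc i"; auto simp: sorted_wrt_nth_less)+
  then show False using assms(3) i j by (auto simp: rising_def)
qed

lemma minimum_label_imp_delta_min:
  assumes "sorted_wrt (<) xs" "\<delta> > 0" "is_minimum xs F x" "\<delta> \<le> scale_label xs F x"
  shows "delta_min (set xs) F \<delta> x"
proof (rule ccontr)
  assume "\<not> ?thesis"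
  then have "delta_max (set xs) F \<delta> x"
    using assms(2,4) scale_label_ge_iff_delta_extremum by blast
  then show False
    using minimum_not_top_of_rising[OF assms(1,3)] minimum_not_bottom_of_falling[OF assms(1,3)]
    by (auto simp: delta_min_def maximal_rising_def)
qed

text \<open>A lower neighbour would call for a barrier strictly between two adjacent points of the
  domain. As adjacent values differ, a neighbour that is not lower is higher.\<close>

lemma delta_min_imp_minimum:
  assumes "sorted_wrt (<) xs" "\<delta> > 0" "\<And>i. Suc i < length xs \<Longrightarrow> F (xs ! i) \<noteq> F (xs ! Suc i)"
    "delta_min (set xs) F \<delta> p"
  shows "is_minimum xs F p"
proof -
  obtain i where i: "i < length xs" "p = xs ! i"
    using delta_min_in[OF assms(4)] by (auto simp: in_set_conv_nth)
  have no_between: False if w: "w \<in> set xs" "xs ! k < w" "w < xs ! Suc k" "Suc k < length xs" for w k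
  proof -
    obtain l where "l < length xs" "w = xs ! l" using w(1) by (auto simp: in_set_conv_nth)
    then show False using w strict_sorted_nth_less_iff[OF assms(1)] by simp
  qed
  have "F (xs ! i) < F (xs ! (i - 1))" if "i \<noteq> 0"
  proof (rule ccontr)
    obtain k where k: "i = Suc k" using \<open>i \<noteq> 0\<close> not0_implies_Suc by blast
    assume "\<not> ?thesis"
    then have less: "F (xs ! k) < F p" "xs ! k < p" "xs ! k \<in> set xs"
      using assms(3)[of k] i k strict_sorted_nth_less_iff[OF assms(1), of k i] by auto
    obtain w where "w \<in> set xs" "xs ! k < w" "w < p"
      by (rule delta_min_barrier_left[OF finite_set assms(4) less(3,2,1)])
    then show False using no_between i k by blast
  qed
  moreover have "F (xs ! i) < F (xs ! Suc i)" if "Suc i \<noteq> length xs"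
  proof (rule ccontr)
    have Si: "Suc i < length xs" using that i by simp
    assume "\<not> ?thesis"
    then have less: "F (xs ! Suc i) < F p" "p < xs ! Suc i" "xs ! Suc i \<in> set xs"
      using assms(3)[OF Si] i Si strict_sorted_nth_less_iff[OF assms(1), of i "Suc i"] by auto
    obtain w where "w \<in> set xs" "p < w" "w < xs ! Suc i"
      by (rule delta_min_barrier_right[OF finite_set assms(4) less(3,2,1)])
    then show False using no_between i Si by blast
  qed
  ultimately show ?thesis using i by (auto simp: is_minimum_def)
qed

section \<open>OMAFE of a segment and its largest drop\<close>

text \<open>Negating \<open>f\<close> exchanges nondecreasing and nonincreasing approximations
  without changing their errors, so a decreasing segment can be treated as an increasing
  one.\<close>

lemma omafe_segment_uminus: "omafe_segment xs (\<lambda>x. - F x) a b = omafe_segment xs F a b"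
proof -
  let ?E = "\<lambda>F f. Max ((\<lambda>x. \<bar>f x - F x\<bar>) ` (set xs \<inter> {a..b}))"
  have E: "?E (\<lambda>x. - F x) f = ?E F (\<lambda>x. - f x)" for f F :: "real \<Rightarrow> real"
    by (rule arg_cong[of _ _ Max], rule image_cong) (auto simp: abs_if)
  have anti: "(\<lambda>f x. - f x) ` {f :: real \<Rightarrow> real. mono f} = {f. antimono f}"
    (is "?m ` _ = _")
  proof (intro equalityI subsetI)
    fix f :: "real \<Rightarrow> real" assume "f \<in> {f. antimono f}"
    then have "mono (\<lambda>x. - f x)" by (auto simp: monotone_def)
    then show "f \<in> ?m ` {f. mono f}" by (intro image_eqI[of _ _ "\<lambda>x. - f x"]) auto
  qed (auto simp: monotone_def)
  have mon: "?m ` {f :: real \<Rightarrow> real. antimono f} = {f. mono f}"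
    unfolding anti[symmetric] image_image by simp
  have "?E (\<lambda>x. - F x) ` X = ?E F ` (?m ` X)" for X
    unfolding E by (simp add: image_image)
  from this[of "{f. mono f}"] this[of "{f. antimono f}"]
  have "?E (\<lambda>x. - F x) ` {f. mono f} = ?E F ` {f. antimono f}"
    "?E (\<lambda>x. - F x) ` {f. antimono f} = ?E F ` {f. mono f}"
    unfolding anti mon .
  moreover have "Max ((\<lambda>x. - F x) ` I) - Min ((\<lambda>x. - F x) ` I) = Max (F ` I) - Min (F ` I)"
    if "finite I" for I
  proof (cases "I = {}")
    case False
    then have "- Max (F ` I) = Min ((\<lambda>x. - F x) ` I)" "- Min (F ` I) = Max ((\<lambda>x. - F x) ` I)"
      using minus_Max_eq_Min[of "F ` I"] minus_Min_eq_Max[of "F ` I"] that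
      unfolding image_image by auto
    then show ?thesis by linarith
  qed simp
  ultimately show ?thesis
    by (auto simp: omafe_segment_def increasing_def decreasing_def)
qed

text \<open>A nondecreasing \<open>f\<close> with error below \<open>e / 2\<close> gives
  \<open>F s < f s + e / 2 \<le> f t + e / 2 < F t + e\<close>. Admitting \<open>F a = F b\<close>
  covers segments without direction, where the range bounds every drop.\<close>

lemma drop_lt_if_omafe_segment_lt:
  assumes "F a \<le> F b" "2 * omafe_segment xs F a b < e" "s \<in> set xs" "t \<in> set xs" "a \<le> s" "s \<le> t" "t \<le> b"
  shows "F s < F t + e"
proof -
  let ?I = "set xs \<inter> {a..b}"
  have st: "s \<in> ?I" "t \<in> ?I" using assms by auto
  show ?thesis
  proof (cases "F a = F b")
    case True
    then have "omafe_segment xs F a b = (Max (F ` ?I) - Min (F ` ?I)) / 2"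
      by (simp add: omafe_segment_def increasing_def decreasing_def)
    moreover have "F s \<le> Max (F ` ?I)" "Min (F ` ?I) \<le> F t"
      using st by (auto intro!: Max_ge Min_le)
    ultimately show ?thesis using assms(2) by simp
  next
    case False
    then have "(INF f \<in> {f :: real \<Rightarrow> real. mono f}. Max ((\<lambda>x. \<bar>f x - F x\<bar>) ` ?I)) < e / 2"
      using assms(1,2) by (simp add: omafe_segment_def increasing_def)
    moreover have "{f :: real \<Rightarrow> real. mono f} \<noteq> {}" by (auto intro: exI[of _ id] simp: mono_def)
    ultimately obtain f :: "real \<Rightarrow> real" where f: "mono f" "Max ((\<lambda>x. \<bar>f x - F x\<bar>) ` ?I) < e / 2"
      using cInf_lessD[of "(\<lambda>f. Max ((\<lambda>x. \<bar>f x - F x\<bar>) ` ?I)) ` {f. mono f}" "e / 2"] by auto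
    have "\<bar>f x - F x\<bar> < e / 2" if "x \<in> ?I" for x
      using f(2) that by (intro order_le_less_trans[OF Max_ge f(2)]) auto
    from this[OF st(1)] this[OF st(2)] monoD[OF f(1) assms(6)] show ?thesis
      by (auto simp: abs_if split: if_splits)
  qed
qed

text \<open>The running maximum of \<open>F\<close>, lowered by half of the largest drop, approximates \<open>F\<close>
  within half of the largest drop.\<close>

lemma omafe_segment_le_half_drop:
  assumes "F a < F b" "a \<in> set xs" "b \<in> set xs" "a < b"
  obtains s t where "s \<in> set xs" "t \<in> set xs" "a \<le> s" "s \<le> t" "t \<le> b"
    "F t + 2 * omafe_segment xs F a b \<le> F s"
proof -
  let ?I = "set xs \<inter> {a..b}"
  define S where "S = {(s, t). s \<in> ?I \<and> t \<in> ?I \<and> s \<le> t}"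
  have "finite S" by (rule finite_subset[of _ "set xs \<times> set xs"]) (auto simp: S_def)
  moreover have "(a, a) \<in> S" using assms by (auto simp: S_def)
  ultimately obtain c where c: "c \<in> S"
    and least: "\<And>v. v \<in> S \<Longrightarrow> F (snd c) - F (fst c) \<le> F (snd v) - F (fst v)"
    using finite_obtain_arg_min[of S "\<lambda>v. F (snd v) - F (fst v)"] by blast
  obtain s t where st: "c = (s, t)" by (cases c)
  define M where "M = F s - F t"
  have M: "F u - F v \<le> M" if "u \<in> ?I" "v \<in> ?I" "u \<le> v" for u v
    using least[of "(u, v)"] that by (simp add: S_def M_def st)
  \<comment> \<open>Inserting \<open>a\<close> keeps \<open>A x\<close> nonempty for every real
    \<open>x\<close>, so that \<open>f\<close> is nondecreasing on the whole line and not just on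
    the segment.\<close>
  define A where "A x = insert a {u \<in> ?I. u \<le> x}" for x
  define f where "f x = Max (F ` A x) - M / 2" for x
  have fin: "finite (A x)" for x by (auto simp: A_def)
  have "mono f"
    unfolding f_def by (intro monoI diff_right_mono Max_mono image_mono) (use fin in \<open>auto simp: A_def\<close>)
  have close: "\<bar>f x - F x\<bar> \<le> M / 2" if x: "x \<in> ?I" for x
  proof -
    have "F x \<le> Max (F ` A x)" using x fin by (auto simp: A_def intro!: Max_ge)
    moreover have "Max (F ` A x) \<le> F x + M"
    proof (subst Max_le_iff)
      have "a \<in> ?I" using assms by auto
      then show "\<forall>y\<in>F ` A x. y \<le> F x + M"
        using M[of _ x] x by (auto simp: A_def diff_le_eq add.commute)
    qed (use fin in \<open>auto simp: A_def\<close>)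
    ultimately show ?thesis by (simp add: f_def abs_if)
  qed
  have ne: "?I \<noteq> {}" using assms by auto
  have "omafe_segment xs F a b = (INF f \<in> {f :: real \<Rightarrow> real. mono f}. Max ((\<lambda>x. \<bar>f x - F x\<bar>) ` ?I))"
    using assms(1) by (simp add: omafe_segment_def increasing_def)
  also have "\<dots> \<le> Max ((\<lambda>x. \<bar>f x - F x\<bar>) ` ?I)"
  proof (rule cINF_lower)
    have "0 \<le> Max ((\<lambda>x. \<bar>f x - F x\<bar>) ` ?I)" for f
      using assms by (intro order_trans[OF _ Max_ge[of _ "\<bar>f a - F a\<bar>"]]) auto
    then show "bdd_below ((\<lambda>f. Max ((\<lambda>x. \<bar>f x - F x\<bar>) ` ?I)) ` {f. mono f})" by (intro bdd_belowI2)
  qed (use \<open>mono f\<close> in simp)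
  also have "\<dots> \<le> M / 2" using close ne by (subst Max_le_iff) auto
  finally have "F t + 2 * omafe_segment xs F a b \<le> F s" by (simp add: M_def)
  then show thesis using that c by (auto simp: S_def st)
qed

section \<open>Zigzags against alternating segments\<close>

text \<open>The flag tells whether the current pair is read upwards or downwards and flips from pair
  to pair. Sequences of delta-extrema, zigzags and the segments of \<open>Q\<close> are all
  instances, so the parity bookkeeping is shared.\<close>

fun alternating :: "(bool \<Rightarrow> 'a \<Rightarrow> 'a \<Rightarrow> bool) \<Rightarrow> bool \<Rightarrow> 'a list \<Rightarrow> bool" where
  "alternating R b (x # y # zs) \<longleftrightarrow> R b x y \<and> alternating R (\<not> b) (y # zs)"
| "alternating R b _ \<longleftrightarrow> True"

lemma alternating_iff_nth:
  "alternating R b l \<longleftrightarrow> (\<forall>i. Suc i < length l \<longrightarrow> R (b = even i) (l ! i) (l ! Suc i))"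
proof (induction R b l rule: alternating.induct)
  case (1 R b x y zs)
  have [simp]: "((\<not> b) = even i) = (b = odd i)" for i by auto
  have "(\<forall>i. Suc i < length (x # y # zs) \<longrightarrow> R (b = even i) ((x # y # zs) ! i) ((x # y # zs) ! Suc i)) \<longleftrightarrow>
      R b x y \<and> (\<forall>i. Suc i < length (y # zs) \<longrightarrow> R ((\<not> b) = even i) ((y # zs) ! i) ((y # zs) ! Suc i))"
    by (simp add: All_less_Suc2)
  then show ?case using 1 by simp
qed auto

lemma alternating_append:
  "alternating R b (l1 @ x # l2) \<longleftrightarrow>
     alternating R b (l1 @ [x]) \<and> alternating R (b = even (length l1)) (x # l2)"
proof (induction l1 arbitrary: b)
  case (Cons y l1)
  then show ?case by (cases l1) auto
qed simp

lemma alternating_mono: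
  assumes "alternating R b l" "\<And>b x y. x \<in> set l \<Longrightarrow> y \<in> set l \<Longrightarrow> R b x y \<Longrightarrow> R' b x y"
  shows "alternating R' b l"
  using assms by (auto simp: alternating_iff_nth)

definition oriented :: "bool \<Rightarrow> (real \<Rightarrow> real) \<Rightarrow> real \<Rightarrow> real" where
  "oriented b F = (if b then F else (\<lambda>x. - F x))"

lemma oriented_not: "oriented (\<not> b) F = (\<lambda>x. - oriented b F x)"
  by (simp add: oriented_def)

definition big_step :: "(real \<Rightarrow> real) \<Rightarrow> real \<Rightarrow> bool \<Rightarrow> real \<Rightarrow> real \<Rightarrow> bool" where
  "big_step F e b x y \<longleftrightarrow> x < y \<and> oriented b F x + e \<le> oriented b F y"

definition no_drop :: "real set \<Rightarrow> (real \<Rightarrow> real) \<Rightarrow> real \<Rightarrow> bool \<Rightarrow> real \<Rightarrow> real \<Rightarrow> bool" where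
  "no_drop D F e b u v \<longleftrightarrow>
     (\<forall>s\<in>D. \<forall>t\<in>D. u \<le> s \<and> s \<le> t \<and> t \<le> v \<longrightarrow> oriented b F s < oriented b F t + e)"

definition delta_step :: "real set \<Rightarrow> (real \<Rightarrow> real) \<Rightarrow> real \<Rightarrow> bool \<Rightarrow> real \<Rightarrow> real \<Rightarrow> bool" where
  "delta_step D F \<delta> b x y \<longleftrightarrow>
     x < y \<and> delta_min D (oriented b F) \<delta> x \<and> delta_min D (oriented (\<not> b) F) \<delta> y"

lemma zigzag_le_last: "alternating (big_step F e) b (w # ws) \<Longrightarrow> w \<le> last (w # ws)"
proof (induction ws arbitrary: b w)
  case (Cons x ws)
  then have "w < x" "x \<le> last (x # ws)" by (auto simp: big_step_def)
  then show ?case by simp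
qed simp

text \<open>A step starting in a segment of the wrong direction must leave it, so each step advances the
  segment count, where a wrong direction at the start counts as one segment ahead.\<close>

lemma zigzag_length_le:
  assumes "alternating (big_step F e) b (z # w # ws)" "set (z # w # ws) \<subseteq> D"
    "alternating (no_drop D F e) c (u # us)" "u \<le> z" "last (w # ws) \<le> last (u # us)"
  shows "Suc (length ws) + (if b = c then 0 else 1) \<le> length us"
  using assms
proof (induction "length ws + length us" arbitrary: b z w ws c u us rule: less_induct)
  case less
  have zw: "z < w" "oriented b F z + e \<le> oriented b F w" and alt: "alternating (big_step F e) (\<not> b) (w # ws)"
    using less.prems(1) by (auto simp: big_step_def)
  have wl: "w \<le> last (u # us)" using zigzag_le_last[OF alt] less.prems(5) by linarith
  show ?case
  proof (cases us)
    case Nil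
    then show ?thesis using wl zw less.prems(4) by simp
  next
    case (Cons v vs)
    have uv: "no_drop D F e c u v" and alt_us: "alternating (no_drop D F e) (\<not> c) (v # vs)"
      using less.prems(3) Cons by auto
    have last_eq: "last (u # us) = last (v # vs)" using Cons by simp
    show ?thesis
    proof (cases "v \<le> z")
      case True
      \<comment> \<open>The segment ends before the step starts. Dropping it flips the direction,
        and the dropped segment pays for the offset this may cost.\<close>
      have "Suc (length ws) + (if b = (\<not> c) then 0 else 1) \<le> length vs"
        using less.hyps[OF _ less.prems(1,2) alt_us True] less.prems(5) last_eq Cons by simp
      then show ?thesis using Cons by (auto split: if_splits)
    next
      case False
      show ?thesis
      proof (cases "b = c")
        case True
        show ?thesis
        proof (cases ws)
          case Nil then show ?thesis using True Cons by simp
        next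
          case (Cons x xs)
          \<comment> \<open>Only the step is dropped. The next step opposes the same segment, and
            the resulting offset 1 accounts for the dropped step.\<close>
          have "Suc (length xs) + (if (\<not> b) = c then 0 else 1) \<le> length us"
            by (rule less.hyps[where w = x and z = w]) (use less.prems alt zw Cons in auto)
          then show ?thesis using True Cons by simp
        qed
      next
        case False': False
        have "v < w"
        proof (rule ccontr)
          assume "\<not> v < w"
          then have "oriented c F z < oriented c F w + e"
            using uv zw less.prems(2,4) unfolding no_drop_def by auto
          moreover have "b = (\<not> c)" using False' by auto
          ultimately show False using zw(2) by (simp add: oriented_not)
        qed
        show ?thesis
        proof (cases ws)
          case Nil
          have "vs \<noteq> []" using \<open>v < w\<close> wl last_eq by auto
          then show ?thesis using Nil Cons False' by (cases vs) auto
        next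
          case ws: (Cons x xs)
          have "Suc (length xs) + (if (\<not> b) = (\<not> c) then 0 else 1) \<le> length vs"
            by (rule less.hyps[where w = x and z = w])
              (use less.prems alt alt_us \<open>v < w\<close> last_eq ws Cons in auto)
          then show ?thesis using False' ws Cons by simp
        qed
      qed
    qed
  qed
qed

section \<open>Values of F around a maximal alternating sequence\<close>

text \<open>\<open>maximal\<close> ranges over both starting flags because an extremum put in front
  of the sequence reverses the flag.\<close>

locale maximal_delta_sequence =
  fixes D :: "real set" and F :: "real \<Rightarrow> real" and \<delta> :: real and b :: bool and ys :: "real list"
  assumes finite: "finite D" and pos: "\<delta> > 0"
    and alt: "alternating (delta_step D F \<delta>) b ys"
    and maximal: "\<And>c zs. alternating (delta_step D F \<delta>) c zs \<Longrightarrow> \<not> set ys \<subset> set zs"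
begin

lemma strictly_sorted: "sorted_wrt (<) ys"
  using alt by (auto simp: sorted_wrt_iff_nth_Suc_transp alternating_iff_nth delta_step_def)

text \<open>The flag \<open>d\<close> turns the gap into a rise. A maximum followed by a minimum is
  inserted at once, so the types of all later entries still fit.\<close>

lemma gap:
  assumes ys: "ys = pre @ p # q # suf" and d: "d = (b = even (length pre))"
  shows "p < q" "delta_min D (oriented d F) \<delta> p" "delta_max D (oriented d F) \<delta> q"
    and "\<And>s t. s \<in> D \<Longrightarrow> t \<in> D \<Longrightarrow> p \<le> s \<Longrightarrow> s < t \<Longrightarrow> t \<le> q \<Longrightarrow> oriented d F s < oriented d F t + \<delta>"
proof -
  have alt': "alternating (delta_step D F \<delta>) b (pre @ [p])"
    "alternating (delta_step D F \<delta>) d (p # q # suf)"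
    using alt unfolding ys by (subst (asm) alternating_append; simp add: d)+
  then show pq: "p < q" "delta_min D (oriented d F) \<delta> p" "delta_max D (oriented d F) \<delta> q"
    by (auto simp: delta_step_def oriented_not)
  fix s t assume st: "s \<in> D" "t \<in> D" "p \<le> s" "s < t" "t \<le> q"
  show "oriented d F s < oriented d F t + \<delta>"
  proof (rule ccontr)
    assume "\<not> ?thesis"
    then have "oriented d F t + \<delta> \<le> oriented d F s" by simp
    then obtain a c where ac: "delta_max D (oriented d F) \<delta> a" "delta_min D (oriented d F) \<delta> c"
        "p < a" "a < c" "c < q"
      by (rule delta_extrema_inside_gap[OF finite pos pq(2,3) st])
    have "alternating (delta_step D F \<delta>) b (pre @ p # a # c # q # suf)"
      by (subst alternating_append)
        (use alt' ac pq in \<open>auto simp: d[symmetric] delta_step_def oriented_not\<close>)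
    moreover have "a \<notin> set ys"
      using strictly_sorted ac unfolding ys by (auto simp: sorted_wrt_append)
    ultimately show False using maximal[of b "pre @ p # a # c # q # suf"] ys by auto
  qed
qed

lemma zigzag: "alternating (big_step F \<delta>) b ys"
  unfolding alternating_iff_nth
proof (intro allI impI)
  fix i assume i: "Suc i < length ys"
  have ys: "ys = take i ys @ ys ! i # ys ! Suc i # drop (Suc (Suc i)) ys"
    using i by (metis Cons_nth_drop_Suc Suc_lessD append_take_drop_id)
  have d: "(b = even i) = (b = even (length (take i ys)))" using i by simp
  note g = gap[OF ys d]
  show "big_step F \<delta> (b = even i) (ys ! i) (ys ! Suc i)"
    using no_drop_step[OF finite pos g(2,3,1,4)] g(1) by (simp add: big_step_def)
qed

text \<open>\<open>zs \<noteq> []\<close> provides the step that identifies \<open>y\<close> as a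
  delta-minimum in this orientation. The lower bound follows from the upper one: a point below
  \<open>y\<close> calls for a barrier that is too high.\<close>

lemma before_first:
  assumes ys: "ys = y # zs" "zs \<noteq> []" and z: "z \<in> D" "z \<le> y"
  shows "oriented b F y \<le> oriented b F z" "oriented b F z < oriented b F y + \<delta>"
proof -
  let ?G = "oriented b F"
  have y: "delta_min D ?G \<delta> y" using alt ys by (cases zs) (auto simp: delta_step_def)
  have none: False if "delta_max D ?G \<delta> p" "p < y" for p
  proof -
    have "alternating (delta_step D F \<delta>) (\<not> b) (p # ys)"
      using alt y that by (simp add: ys(1) delta_step_def oriented_not)
    moreover have "p \<notin> set ys" using strictly_sorted that(2) by (auto simp: ys(1))
    ultimately show False using maximal[of "\<not> b" "p # ys"] by auto
  qed
  have upper: "?G z < ?G y + \<delta>" if z: "z \<in> D" "z \<le> y" for z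
  proof (rule ccontr)
    assume "\<not> ?thesis"
    then have "- ?G z + \<delta> \<le> - ?G y" "z < y" using z pos by (auto simp: less_le)
    then obtain p where "delta_max D ?G \<delta> p" "p < y"
      using rise_delta_extrema[OF finite pos z(1) delta_min_in[OF y], of "\<lambda>x. - ?G x"] by blast
    then show False by (rule none)
  qed
  show "?G z < ?G y + \<delta>" using upper z .
  show "?G y \<le> ?G z"
  proof (rule ccontr)
    assume "\<not> ?thesis"
    then have "?G z < ?G y" "z < y" using z by (auto simp: less_le)
    then obtain w where "w \<in> D" "w < y" "?G y + \<delta> \<le> ?G w"
      using delta_min_barrier_left[OF finite y z(1)] by metis
    then show False using upper[of w] by simp
  qed
qed

lemma after_last:
  assumes ys: "ys = zs @ [y]" "zs \<noteq> []" and z: "z \<in> D" "y \<le> z" and d: "d = (b = even (length zs))"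
  shows "oriented d F y \<le> oriented d F z" "oriented d F z < oriented d F y + \<delta>"
proof -
  let ?G = "oriented d F"
  obtain us u where zs: "zs = us @ [u]" using ys(2) rev_exhaust by blast
  have "alternating (delta_step D F \<delta>) (b = even (length us)) [u, y]"
    using alt unfolding ys zs by (subst (asm) append_assoc, subst (asm) append_Cons, subst (asm) alternating_append) simp
  then have y: "delta_min D ?G \<delta> y" using d by (auto simp: zs delta_step_def)
  have none: False if "delta_max D ?G \<delta> p" "y < p" for p
  proof -
    have "alternating (delta_step D F \<delta>) b (zs @ [y, p])"
      by (subst alternating_append)
        (use alt ys y that in \<open>auto simp: d[symmetric] delta_step_def oriented_not\<close>)
    moreover have "p \<notin> set ys" using strictly_sorted that(2) by (auto simp: ys(1) sorted_wrt_append)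
    ultimately show False using maximal[of b "zs @ [y, p]"] by (auto simp: ys)
  qed
  have upper: "?G z < ?G y + \<delta>" if z: "z \<in> D" "y \<le> z" for z
  proof (rule ccontr)
    assume "\<not> ?thesis"
    then have "?G y + \<delta> \<le> ?G z" "y < z" using z pos by (auto simp: less_le)
    then obtain p where "delta_max D ?G \<delta> p" "y < p"
      using rise_delta_extrema[OF finite pos delta_min_in[OF y] z(1), of ?G] by blast
    then show False by (rule none)
  qed
  show "?G z < ?G y + \<delta>" using upper z .
  show "?G y \<le> ?G z"
  proof (rule ccontr)
    assume "\<not> ?thesis"
    then have "?G z < ?G y" "y < z" using z by (auto simp: less_le)
    then obtain w where "w \<in> D" "y < w" "?G y + \<delta> \<le> ?G w"
      using delta_min_barrier_right[OF finite y z(1)] by metis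
    then show False using upper[of w] by simp
  qed
qed

text \<open>A largest drop against the direction of the segment \<open>[a, c]\<close> lengthens the zigzag:
  it is inserted between \<open>p\<close> and \<open>q\<close>, or, if it reaches beyond the first or last
  extremum, contributes one new end point.\<close>

lemma segment_zigzag:
  assumes ys: "ys = pre @ p # q # suf" and "pre \<noteq> [] \<or> suf \<noteq> []" and D: "D = set xs"
    and a: "a \<in> D" "a \<le> p" "pre \<noteq> [] \<Longrightarrow> a = p" and c: "c \<in> D" "q \<le> c" "suf \<noteq> [] \<Longrightarrow> c = q"
    and e: "e = 2 * omafe_segment xs F a c" "e > 0"
  obtains zs d where "alternating (big_step F e) d zs" "set zs \<subseteq> D" "length ys < length zs"
proof -
  define d where "d = (b = even (length pre))"
  define G where "G = oriented d F"
  note g = gap[OF ys d_def, folded G_def]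
  have pq: "p \<in> D" "q \<in> D" using g(2,3) delta_min_in by auto
  have ysD: "set ys \<subseteq> D"
  proof
    fix y assume "y \<in> set ys"
    then obtain i where i: "i < length ys" "y = ys ! i" by (auto simp: in_set_conv_nth)
    have "Suc i < length ys \<or> (\<exists>k. i = Suc k)" using ys i by (cases i) auto
    then show "y \<in> D"
      using alt i delta_min_in unfolding alternating_iff_nth delta_step_def by blast
  qed
  have inside: "G p \<le> G z" "G z \<le> G q" if "z \<in> D" "p \<le> z" "z \<le> q" for z
    using no_drop_bounds[OF finite pos g(2,3) that g(4)] by blast+
  have step: "G p + \<delta> \<le> G q" using no_drop_step[OF finite pos g(2,3,1,4)] by blast
  have left: "G p \<le> G z \<and> G z < G p + \<delta>" if "z \<in> D" "a \<le> z" "z \<le> p" for z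
  proof (cases "pre = []")
    case True
    then show ?thesis using before_first[of p "q # suf" z] that by (simp add: ys G_def d_def)
  qed (use a(3) that pos in force)
  have right: "G z \<le> G q \<and> G q < G z + \<delta>" if "z \<in> D" "q \<le> z" "z \<le> c" for z
  proof (cases "suf = []")
    case True
    have neg: "oriented (\<not> d) F = (\<lambda>x. - G x)" by (simp add: G_def oriented_not)
    have "ys = (pre @ [p]) @ [q]" "(\<not> d) = (b = even (length (pre @ [p])))"
      using True by (auto simp: ys d_def)
    from after_last[OF this(1) _ that(1,2) this(2)] show ?thesis unfolding neg by simp
  qed (use c(3) that pos in force)
  \<comment> \<open>The segment exceeds its gap on at most one side. With both ends free,
    \<open>G a\<close> and \<open>G c\<close> could be ordered against \<open>p\<close> and
    \<open>q\<close>, and the segment would not have the direction of the gap.\<close>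
  have one: "a = p \<or> c = q" using assms(2) a(3) c(3) by auto
  have Gac: "G a < G c" using one left[of a] right[of c] step a c pos by auto
  have "omafe_segment xs G a c = omafe_segment xs F a c"
    using omafe_segment_uminus[of xs F a c] by (simp add: G_def oriented_def)
  moreover have "a < c" using a c g(1) by linarith
  ultimately obtain s t where st: "s \<in> D" "t \<in> D" "a \<le> s" "s \<le> t" "t \<le> c" and drop: "G t + e \<le> G s"
    using omafe_segment_le_half_drop[of G a c xs] Gac a(1) c(1) unfolding D e(1) by metis
  have "s < t" using st(4) drop e(2) by (auto simp: less_le)
  have mono: "alternating (big_step F e) b' l"
    if "e \<le> \<delta>" "alternating (big_step F \<delta>) b' l" for b' l
    using that(2) by (rule alternating_mono) (use that(1) in \<open>auto simp: big_step_def\<close>)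
  consider (before) "s < p" | (after) "p \<le> s" "q < t" | (inner) "p \<le> s" "t \<le> q" by linarith
  then show thesis
  proof cases
    case before
    have "pre = []" using before a(3) st(3) by force
    have "t \<le> q" using one before st by auto
    then have "G p \<le> G t" using inside[of t] left[of t] st by (cases "t \<le> p") auto
    then have s: "G p + e \<le> G s" using drop by simp
    moreover have "G s < G p + \<delta>" using left[of s] st \<open>s < p\<close> by simp
    \<comment> \<open>The two bounds on \<open>G s\<close> give \<open>e < \<delta>\<close>, so the
      old steps are large enough.\<close>
    ultimately have "alternating (big_step F e) b ys" using mono zigzag by auto
    then have "alternating (big_step F e) (\<not> b) (s # ys)"
      using s \<open>s < p\<close> \<open>pre = []\<close> by (simp add: ys big_step_def oriented_not G_def d_def)
    then show thesis using that[of _ "s # ys"] ysD st by simp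
  next
    case after
    have "suf = []" using after c(3) st(5) by force
    have "G s \<le> G q" using inside[of s] right[of s] st \<open>p \<le> s\<close> by (cases "s \<le> q") auto
    then have t: "G t + e \<le> G q" using drop by simp
    moreover have "G q < G t + \<delta>" using right[of t] st \<open>q < t\<close> by simp
    ultimately have "alternating (big_step F e) b ys" using mono zigzag by auto
    moreover have "oriented (b = odd (length pre)) F = (\<lambda>x. - G x)"
      by (auto simp: G_def d_def oriented_def)
    ultimately have "alternating (big_step F e) b ((pre @ [p]) @ q # [t])"
      using t \<open>q < t\<close> \<open>suf = []\<close>
      by (subst alternating_append) (auto simp: ys big_step_def)
    then show thesis using that[of _ "ys @ [t]"] ysD st \<open>suf = []\<close> by (simp add: ys)
  next
    case inner
    have "e \<le> \<delta>" using g(4)[of s t] st \<open>s < t\<close> inner drop by simp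
    \<comment> \<open>The drop ends no lower than \<open>p\<close> and starts no higher than
      \<open>q\<close>, so both remaining pieces are rises of at least \<open>e\<close>: three steps
      replace one.\<close>
    have Gs: "G p + e \<le> G s" "G t + e \<le> G q"
      using inside[of s] inside[of t] st inner drop by auto
    have strict: "p < s" "t < q"
      using Gs drop e(2) inner inside[of s] inside[of t] st by (auto simp: less_le)
    have "alternating (big_step F e) b ys" using mono[OF \<open>e \<le> \<delta>\<close>] zigzag by auto
    then have "alternating (big_step F e) b (pre @ [p])" "alternating (big_step F e) d (p # q # suf)"
      unfolding ys by (subst (asm) alternating_append; simp add: d_def)+
    then have "alternating (big_step F e) b (pre @ p # s # t # q # suf)"
      using Gs strict \<open>s < t\<close> drop
      by (subst alternating_append) (auto simp: d_def[symmetric] big_step_def oriented_not G_def)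
    then show thesis using that[of _ "pre @ p # s # t # q # suf"] ysD st by (simp add: ys)
  qed
qed

end

section \<open>Transfer to the given sequence and segmentations\<close>

lemma alternating_delta_extrema_imp:
  assumes xs: "sorted_wrt (<) xs" and "\<delta> > 0" and alt: "alternating_delta_extrema xs F \<delta> ys"
  obtains b where "alternating (delta_step (set xs) F \<delta>) b ys"
proof -
  define b where "b = is_minimum xs F (ys ! 0)"
  have steps: "ys ! i < ys ! Suc i" "is_maximum xs F (ys ! i) \<and> is_minimum xs F (ys ! Suc i) \<or>
      is_minimum xs F (ys ! i) \<and> is_maximum xs F (ys ! Suc i)" if "Suc i < length ys" for i
    using alt that by (auto simp: alternating_delta_extrema_def sorted_wrt_nth_less)
  have label: "is_extremum xs F (ys ! i)" "\<delta> \<le> scale_label xs F (ys ! i)" if "i < length ys" for i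
    using alt that by (auto simp: alternating_delta_extrema_def)
  have min: "delta_min (set xs) F \<delta> y" if "is_minimum xs F y" "\<delta> \<le> scale_label xs F y" for y
    using minimum_label_imp_delta_min[OF xs assms(2) that] .
  have max: "delta_max (set xs) F \<delta> y" if "is_maximum xs F y" "\<delta> \<le> scale_label xs F y" for y
    using minimum_label_imp_delta_min[OF xs assms(2), of "\<lambda>x. - F x"] that
    by (simp add: is_maximum_iff_minimum scale_label_uminus)
  \<comment> \<open>The point of a one-point domain is both a maximum and a minimum by definition; a
    positive label rules this case out.\<close>
  have excl: False if "is_minimum xs F y" "is_maximum xs F y" "\<delta> \<le> scale_label xs F y" for y
    using min[OF that(1,3)] minimum_not_top_of_rising[OF xs, of "\<lambda>x. - F x" y]
      minimum_not_bottom_of_falling[OF xs, of "\<lambda>x. - F x" y] that(2)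
    by (auto simp: is_maximum_iff_minimum delta_min_def maximal_rising_def)
  have parity: "is_minimum xs F (ys ! i) \<longleftrightarrow> b = even i" if "i < length ys" for i
    using that
  proof (induction i)
    case (Suc i)
    then show ?case
      using steps(2)[of i] excl[of "ys ! i"] excl[of "ys ! Suc i"] label(2)[of i] label(2)[of "Suc i"]
      by auto
  qed (simp add: b_def)
  have "delta_min (set xs) (oriented (b = even i) F) \<delta> (ys ! i)" if "i < length ys" for i
    using parity[OF that] label[OF that] min max by (auto simp: oriented_def is_extremum_def)
  from this this[of "Suc _"] show thesis
    by (intro that[of b]) (auto simp: alternating_iff_nth delta_step_def steps(1))
qed

text \<open>With at least two entries every entry takes part in a step; on shorter lists
  \<open>alternating\<close> says nothing about the entries.\<close>

lemma alternating_imp_delta_extrema: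
  assumes xs: "sorted_wrt (<) xs" and "\<delta> > 0"
    and ne: "\<And>i. Suc i < length xs \<Longrightarrow> F (xs ! i) \<noteq> F (xs ! Suc i)"
    and alt: "alternating (delta_step (set xs) F \<delta>) b ys" and "2 \<le> length ys"
  shows "alternating_delta_extrema xs F \<delta> ys"
proof -
  have steps: "ys ! i < ys ! Suc i \<and> delta_min (set xs) (oriented (b = even i) F) \<delta> (ys ! i) \<and>
      delta_min (set xs) (oriented (b = even (Suc i)) F) \<delta> (ys ! Suc i)" if "Suc i < length ys" for i
    using alt that by (auto simp: alternating_iff_nth delta_step_def)
  have dm: "delta_min (set xs) (oriented (b = even i) F) \<delta> (ys ! i)" if "i < length ys" for i
    using steps[of i] steps[of "i - 1"] that assms(5) by (cases i) force+
  have "is_minimum xs (oriented d F) y" if "delta_min (set xs) (oriented d F) \<delta> y" for d y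
    by (rule delta_min_imp_minimum[OF xs assms(2) _ that]) (use ne in \<open>auto simp: oriented_def\<close>)
  then have ext: "if b = even i then is_minimum xs F (ys ! i) else is_maximum xs F (ys ! i)"
    if "i < length ys" for i
    using dm[OF that] by (fastforce simp: oriented_def is_maximum_iff_minimum)
  have "\<delta> \<le> scale_label xs F (ys ! i)" if "i < length ys" for i
    using dm[OF that] scale_label_ge_iff_delta_extremum[OF assms(2)]
    by (auto simp: oriented_def split: if_splits)
  moreover have "is_extremum xs F (ys ! i)" if "i < length ys" for i
    using ext[OF that] by (simp add: is_extremum_def split: if_splits)
  ultimately have "\<forall>y\<in>set ys. is_extremum xs F y \<and> \<delta> \<le> scale_label xs F y"
    by (auto simp: in_set_conv_nth)
  moreover have "sorted_wrt (<) ys"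
    using steps by (auto simp: sorted_wrt_iff_nth_Suc_transp)
  moreover have "is_maximum xs F (ys ! i) \<and> is_minimum xs F (ys ! Suc i) \<or>
      is_minimum xs F (ys ! i) \<and> is_maximum xs F (ys ! Suc i)" if "Suc i < length ys" for i
    using ext[of i] ext[of "Suc i"] that by (auto split: if_splits)
  ultimately show ?thesis by (simp add: alternating_delta_extrema_def)
qed

lemma corresponding_segmentation_nth:
  assumes "length ys = K + 1" "K \<ge> 1" "i \<le> K"
  shows "corresponding_segmentation xs ys ! i =
    (if i = 0 then hd xs else if i = K then last xs else ys ! i)"
  using assms
  by (cases i) (auto simp: corresponding_segmentation_def nth_append nth_butlast nth_tl)

lemma alternating_no_drop_if_omafe_lt:
  assumes Q: "segmentation xs m Q" "alternating_monotonicity F Q" and e: "2 * omafe xs F Q < e"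
  obtains c where "alternating (no_drop (set xs) F e) c Q"
proof -
  \<comment> \<open>If \<open>Q\<close> is a single segment it may have no direction; the weak
    inequality orients it all the same.\<close>
  define c where "c \<longleftrightarrow> F (Q ! 0) \<le> F (Q ! 1)"
  have dir: "oriented (c = even j) F (Q ! j) \<le> oriented (c = even j) F (Q ! Suc j)"
    if "Suc j < length Q" for j
    using that
  proof (induction j)
    case (Suc j)
    then show ?case
      using Q(2)[unfolded alternating_monotonicity_def, rule_format, of j]
      by (auto simp: opposite_direction_def increasing_def decreasing_def oriented_def split: if_splits)
  qed (simp add: c_def oriented_def)
  have "no_drop (set xs) F e (c = even j) (Q ! j) (Q ! Suc j)" if "Suc j < length Q" for j
  proof -
    have "omafe_segment xs (oriented (c = even j) F) (Q ! j) (Q ! Suc j)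
        = omafe_segment xs F (Q ! j) (Q ! Suc j)"
      by (simp add: oriented_def omafe_segment_uminus)
    also have "\<dots> \<le> omafe xs F Q"
      unfolding omafe_def using that by (intro Max_ge) auto
    finally have "2 * omafe_segment xs (oriented (c = even j) F) (Q ! j) (Q ! Suc j) < e"
      using e by simp
    from drop_lt_if_omafe_segment_lt[OF dir[OF that] this] show ?thesis
      by (simp add: no_drop_def)
  qed
  then show thesis by (intro that[of c]) (simp add: alternating_iff_nth)
qed

theorem theorem2:
  fixes xs ys P Q :: "real list" and F :: "real \<Rightarrow> real" and \<delta> :: real and K m :: nat
  assumes "sorted_wrt (<) xs"
    and "\<And>i. Suc i < length xs \<Longrightarrow> F (xs ! i) \<noteq> F (xs ! Suc i)"
    and "\<delta> > 0"
    and "length ys = K + 1"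
    and "maximal_alternating_delta_extrema xs F \<delta> ys"
    and "P = corresponding_segmentation xs ys"
    and "segmentation xs m Q"
    and "alternating_monotonicity F Q"
    and "omafe xs F Q < omafe xs F P"
  shows "m \<ge> K + 1"
proof -
  have ext: "alternating_delta_extrema xs F \<delta> ys"
    and maxi: "\<And>zs. alternating_delta_extrema xs F \<delta> zs \<Longrightarrow> \<not> set ys \<subset> set zs"
    using assms(5) by (auto simp: maximal_alternating_delta_extrema_def)
  have Q: "length Q = m + 1" "hd Q = hd xs" "last Q = last xs" "set Q \<subseteq> set xs"
    using assms(7) by (auto simp: segmentation_def)
  have ends: "hd xs \<le> x" "x \<le> last xs" if x: "x \<in> set xs" for x
  proof -
    obtain i where i: "i < length xs" "x = xs ! i" using x by (auto simp: in_set_conv_nth)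
    then have ne: "xs \<noteq> []" by auto
    have le: "xs ! k \<le> xs ! l" if "k \<le> l" "l < length xs" for k l
      using sorted_wrt_nth_less[OF assms(1), of k l] that by (cases "k = l") auto
    show "hd xs \<le> x" "x \<le> last xs"
      using le[of 0 i] le[of i "length xs - 1"] i ne by (auto simp: hd_conv_nth last_conv_nth)
  qed
  \<comment> \<open>A positive label yields a star pair, hence two distinct points of the domain, so
    \<open>Q\<close> has at least one segment. This settles \<open>K = 0\<close>.\<close>
  have "ys ! 0 \<in> set ys" using assms(4) by simp
  then have "\<delta> \<le> scale_label xs F (ys ! 0)" using ext by (auto simp: alternating_delta_extrema_def)
  then obtain v w where "star_pair xs F v w"
    unfolding scale_label_ge_iff[OF assms(3)] maximal_star_pair_def by blast
  then have vw: "v \<in> set xs" "w \<in> set xs" "v < w" by (auto simp: star_pair_def delta_pair_def)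
  have "m \<noteq> 0"
  proof
    assume "m = 0"
    then have "hd xs = last xs" using Q by (cases Q) auto
    then show False using ends(1)[OF vw(1)] ends(2)[OF vw(2)] vw(3) by simp
  qed
  \<comment> \<open>For \<open>K = 1\<close> the only segment of \<open>P\<close> is the whole
    domain, free at both ends and so out of reach of the zigzag argument; but a one-segment
    \<open>Q\<close> is then \<open>P\<close> itself.\<close>
  have "m \<noteq> 1" if "K = 1"
  proof
    assume "m = 1"
    then obtain u u' where "Q = [u, u']" using Q(1) by (auto simp: length_Suc_conv)
    then have "Q = P" using Q(2,3) assms(4,6) that
      by (auto simp: corresponding_segmentation_def length_Suc_conv)
    then show False using assms(9) by simp
  qed
  then consider "K + 1 \<le> m" | "K \<ge> 2" using \<open>m \<noteq> 0\<close> by linarith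
  then show ?thesis
  proof cases
    case 2
    obtain b where alt: "alternating (delta_step (set xs) F \<delta>) b ys"
      by (rule alternating_delta_extrema_imp[OF assms(1,3) ext])
    have "ys ! 0 < ys ! 1" "ys ! 1 \<in> set ys"
      using ext assms(4) 2 by (auto simp: alternating_delta_extrema_def sorted_wrt_nth_less)
    \<comment> \<open>A proper superset of the sequence has two distinct entries, so it is long
      enough to be translated back into a sequence of extrema.\<close>
    then have long: "2 \<le> length zs" if "set ys \<subset> set zs" for zs
      using that \<open>ys ! 0 \<in> set ys\<close> by (cases zs rule: remdups_adj.cases) auto
    interpret maximal_delta_sequence "set xs" F \<delta> b ys
      using alt assms(3) maxi alternating_imp_delta_extrema[OF assms(1,3,2)] long
      by unfold_locales blast+
    define e where "e = 2 * omafe xs F P"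
    have lenP: "length P = K + 1" using assms(4,6) 2 by (simp add: corresponding_segmentation_def)
    have P: "P ! i = (if i = 0 then hd xs else if i = K then last xs else ys ! i)" if "i \<le> K" for i
      using corresponding_segmentation_nth[OF assms(4) _ that] 2 assms(6) by simp
    have "omafe xs F P \<in> (\<lambda>j. omafe_segment xs F (P ! j) (P ! Suc j)) ` {..<length P - 1}"
      unfolding omafe_def using lenP 2 by (intro Max_in) (auto simp: lessThan_empty_iff)
    then obtain j where j: "j < K" "omafe xs F P = omafe_segment xs F (P ! j) (P ! Suc j)"
      using lenP by auto
    obtain c where c: "alternating (no_drop (set xs) F e) c Q"
      using alternating_no_drop_if_omafe_lt[OF assms(7,8), of e] assms(9) by (auto simp: e_def)
    obtain u u' us where us: "Q = u # u' # us" using Q(1) \<open>m \<noteq> 0\<close> by (cases Q rule: remdups_adj.cases) auto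
    have "u \<le> u'" "u \<in> set xs" using assms(7) us by (auto simp: segmentation_def)
    \<comment> \<open>For \<open>s = t = u\<close>, \<open>no_drop\<close> already compares a value
      with itself plus \<open>e\<close>.\<close>
    then have "e > 0" using c by (auto simp: us no_drop_def dest!: bspec[of _ _ u])
    have ys: "ys = take j ys @ ys ! j # ys ! Suc j # drop (Suc (Suc j)) ys"
      using j(1) assms(4) by (metis Cons_nth_drop_Suc Suc_lessD Suc_less_eq Suc_eq_plus1 append_take_drop_id)
    have ysD: "ys ! i \<in> set xs" if "i \<le> K" for i
      using ext assms(4) that
      by (auto simp: alternating_delta_extrema_def is_extremum_def is_maximum_def is_minimum_def
          dest!: bspec[of _ _ "ys ! i"])
    have xs: "hd xs \<in> set xs" "last xs \<in> set xs" using vw(1) by (cases xs; force)+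
    obtain zs d where zs: "alternating (big_step F e) d zs" "set zs \<subseteq> set xs" "length ys < length zs"
      by (rule segment_zigzag[OF ys, where a = "P ! j" and c = "P ! Suc j" and e = e and xs = xs])
        (use j 2 assms(4) P[of j] P[of "Suc j"] ysD[of j] ysD[of "Suc j"] ends xs \<open>e > 0\<close> e_def in
          \<open>auto split: if_splits\<close>)
    obtain z w ws where zs_eq: "zs = z # w # ws"
      using zs(3) assms(4) 2 by (cases zs rule: remdups_adj.cases) auto
    have "last (w # ws) \<in> set xs" using zs(2) zs_eq last_in_set[of "w # ws"] by auto
    then have "Suc (length ws) + (if d = c then 0 else 1) \<le> length (u' # us)"
      using zs(1,2) zs_eq c us Q(2,3) ends
      by (intro zigzag_length_le[of F e d z w ws "set xs" c u]) auto
    \<comment> \<open>\<open>zs\<close> has at least \<open>K + 2\<close> points and so at least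
      \<open>K + 1\<close> steps, while \<open>u' # us\<close> has one entry for each of the
      \<open>m\<close> segments.\<close>
    then show ?thesis using zs(3) zs_eq assms(4) Q(1) us by simp
  qed
qed

end
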